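(* For every sufficiently small absolute constant $C_0\in(0,1/100)$ with $1/C_0\in\mathbb{N}$ there are constants $K>0$ and $\delta_0\in(0,1)$, depending only on $C_0$ (in particular independent of $p$), such that the following holds. Let $0<\delta<\delta_0$ and let $N\in\mathbb{N}$ satisfy $C_0^{3\cdot3^N}\le\delta\le C_0^{2\cdot3^N}$; put $\tau_0=C_0^{2\cdot2^N}$. Let $A$ be a set of points $(x,y)\in\mathbb{R}^2$ with $x^2+y^2=1$, any two distinct points of which are separated by distance at least $\delta$. Then for all $4<p<6$, $$\Big\|\sum_{a\in A}e^{2\pi i a\cdot z}\Big\|_{L^p_\#(B)}\le\exp\Big(K\big(\log\tfrac1\delta\big)^{1-\sigma_p}\big(\log\log\tfrac1\delta\big)^{K}\Big)|A|^{1/2}$$ for all axis-parallel squares $B\subset\mathbb{R}^2$ of side length $\delta^{-1}\lceil\delta^{-2}\rceil\tau_0^{-2}$.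
   Context: $\sigma_p=\frac14\big(1-\log_2(\frac{p-2}{2})\big)$. For a square $B$, $\|f\|_{L^p_\#(B)}=\big(\frac1{|B|}\int_B|f(z)|^p\,dz\big)^{1/p}$. $|A|$ is the cardinality of $A$. *)

theory Defs
  imports "HOL-Analysis.Analysis"
begin

definition sigma_exp :: "real \<Rightarrow> real" where
  "sigma_exp p = 1/4 * (1 - log 2 ((p - 2) / 2))"

(* Closed squares; the choice of boundary does not affect averages. *)
definition axis_square :: "real \<Rightarrow> real \<Rightarrow> real \<Rightarrow> (real \<times> real) set" where
  "axis_square L u v = {u..u + L} \<times> {v..v + L}"

definition Lp_avg :: "real \<Rightarrow> (real \<times> real) set \<Rightarrow> (real \<times> real \<Rightarrow> complex) \<Rightarrow> real" where
  "Lp_avg p B f =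
     (1 / measure lborel B * set_lebesgue_integral lborel B (\<lambda>z. norm (f z) powr p)) powr (1 / p)"

(* For a separated subset A of the circle, A is finite, so the sum is a genuine one. *)
definition exp_sum :: "(real \<times> real) set \<Rightarrow> real \<times> real \<Rightarrow> complex" where
  "exp_sum A z = (\<Sum>a\<in>A. exp (2 * complex_of_real pi * \<i> * complex_of_real (a \<bullet> z)))"

end

theory Submission
  imports Defs "HOL-Probability.Probability"
begin

text \<open>
  This is a bilinear proof of decoupling in the style of Guo, Li, Yung and Zorin-Kranich, run directly on
  exponential sums over angles. The square enters only through a weight that changes by a bounded
  factor under translations of length \<open>\<delta>\<^sup>-\<^sup>2\<close>; since coefficients are arbitrary, translating a sum is harmless.

  Put \<open>q = p - 2\<close>. If \<open>J\<close> is an arc of length \<open>t\<close>, the frequencies of \<open>f\<^sub>J\<close> vary by at most \<open>t\<^sup>2\<close> in the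
  direction normal to \<open>J\<close>, so \<open>\<bar>f\<^sub>J\<bar> ^ q\<close> is essentially constant at scale \<open>t\<^sup>-\<^sup>2\<close> in that direction. For an
  arc \<open>I\<close> at distance \<open>d\<close> from \<open>J\<close>, one-dimensional orthogonality therefore decouples \<open>I\<close> into arcs of
  length \<open>t\<^sup>2 / d\<close> in \<open>\<integral> \<bar>f\<^sub>I\<bar>\<^sup>2 \<bar>f\<^sub>J\<bar> ^ q\<close>. Hoelder's inequality exchanges the roles of \<open>I\<close> and \<open>J\<close>
  at the cost of an exponent \<open>\<alpha> = 2 / q < 1\<close>, and the lengths square at every step. After \<open>m\<close> steps with \<open>2 ^ m\<close> about
  \<open>ln (1/\<delta>) / ln K\<close> single points are reached and the bilinear constant is at most
  \<open>C ^ m D ^ (1 - \<alpha> ^ m)\<close>, where \<open>D\<close> is the linear constant. The broad-narrow dichotomy with \<open>K\<close> pieces turns this into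
  \<open>D r \<le> 4 ^ 6 D (r / K) + (2 K) ^ 17 C ^ (m + 1) (D r) ^ (1 - \<alpha> ^ m)\<close>, whose solution with
  \<open>ln K\<close> about \<open>(ln (1/\<delta>)) ^ \<sigma>\<^sub>p\<close> is the claimed bound, because \<open>1 / \<alpha> = 2 ^ (1 - 4 \<sigma>\<^sub>p)\<close>.
\<close>

section \<open>Fejer kernels\<close>

lemma integrable_inverse_1_plus_square_lborel: "integrable lborel (\<lambda>x::real. inverse (1 + x\<^sup>2))"
  using integrable_inverse_1_plus_square by (simp add: set_integrable_def)

lemma one_minus_cos_le: "1 - cos x \<le> x\<^sup>2 / 2" for x :: real
proof -
  have "1 - cos x = 2 * (sin (x/2))\<^sup>2"
    using cos_double_sin[of "x/2"] by simp
  also have "(sin (x/2))\<^sup>2 \<le> (x/2)\<^sup>2"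
    using abs_sin_x_le_abs_x[of "x/2"] by (simp only: abs_le_square_iff)
  finally show ?thesis by (simp add: power2_eq_square)
qed

text \<open>Half the squared sinc of \<open>x / 2\<close>. Integrability and scaling suffice below,
  so its integral is never evaluated.\<close>

definition cos_kernel :: "real \<Rightarrow> real" where
  "cos_kernel x = (1 - cos x) / x\<^sup>2"

lemma integrable_cos_kernel: "integrable lborel cos_kernel"
proof (rule Bochner_Integration.integrable_bound)
  show "integrable lborel (\<lambda>x::real. 3 * inverse (1 + x\<^sup>2))"
    using integrable_inverse_1_plus_square_lborel by simp
  show "cos_kernel \<in> borel_measurable lborel"
    unfolding cos_kernel_def by measurable
  \<comment> \<open>The constant 3 covers 1/2 from \<open>1 - cos x \<le> x\<^sup>2 / 2\<close> and
    2 from \<open>1 - cos x \<le> 2\<close>; at 0 the division by zero gives 0.\<close>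
  have "cos_kernel x \<le> 3 * inverse (1 + x\<^sup>2)" for x
  proof (cases "x = 0")
    case False
    have "(1 - cos x) * (1 + x\<^sup>2) = (1 - cos x) + (1 - cos x) * x\<^sup>2" by (simp add: algebra_simps)
    also have "\<dots> \<le> x\<^sup>2 / 2 + 2 * x\<^sup>2"
      by (intro add_mono one_minus_cos_le mult_right_mono) (use cos_ge_minus_one[of x] in simp_all)
    also have "\<dots> \<le> 3 * x\<^sup>2" by simp
    finally have "(1 - cos x) * (1 + x\<^sup>2) \<le> 3 * x\<^sup>2" .
    then show ?thesis
      using False by (simp add: cos_kernel_def field_simps add_pos_nonneg)
  qed (simp add: cos_kernel_def)
  moreover have "0 \<le> cos_kernel x" for x by (simp add: cos_kernel_def)
  ultimately show "AE x in lborel. norm (cos_kernel x) \<le> norm (3 * inverse (1 + x\<^sup>2))"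
    by (intro always_eventually allI) (smt (verit) real_norm_def)
qed

text \<open>The integrand is \<open>a\<^sup>2 * cos_kernel (a * x)\<close>, so substitution leaves
  one power of |a|; these absolute values make the transform of \<open>fejer\<close> piecewise
  linear.\<close>

lemma has_bochner_integral_cos_kernel_scale:
  "has_bochner_integral lborel (\<lambda>x. (1 - cos (a * x)) / x\<^sup>2) (\<bar>a\<bar> * integral\<^sup>L lborel cos_kernel)"
proof (cases "a = 0")
  case False
  have "has_bochner_integral lborel cos_kernel (integral\<^sup>L lborel cos_kernel)"
    by (simp add: has_bochner_integral_integrable integrable_cos_kernel)
  then have "has_bochner_integral lborel (\<lambda>x. cos_kernel (0 + a * x)) (integral\<^sup>L lborel cos_kernel /\<^sub>R \<bar>a\<bar>)"
    using lborel_has_bochner_integral_real_affine_iff[OF False, of cos_kernel _ 0] by blast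
  then have "has_bochner_integral lborel (\<lambda>x. a\<^sup>2 * cos_kernel (0 + a * x)) (a\<^sup>2 * (integral\<^sup>L lborel cos_kernel /\<^sub>R \<bar>a\<bar>))"
    by (rule has_bochner_integral_mult_right)
  moreover have "(\<lambda>x. a\<^sup>2 * cos_kernel (0 + a * x)) = (\<lambda>x. (1 - cos (a * x)) / x\<^sup>2)"
    using False by (simp add: cos_kernel_def power_mult_distrib)
  moreover have "a\<^sup>2 * (integral\<^sup>L lborel cos_kernel /\<^sub>R \<bar>a\<bar>) = \<bar>a\<bar> * integral\<^sup>L lborel cos_kernel"
    using False abs_mult_self_eq[of a] by (simp add: power2_eq_square divide_inverse[symmetric] nonzero_divide_eq_eq)
  ultimately show ?thesis by (simp only:)
qed (simp add: has_bochner_integral_zero)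

text \<open>The squared sinc. Its Fourier transform is a triangle supported on [-2, 2], and this
  compact support is the source of all orthogonality below.\<close>

definition fejer :: "real \<Rightarrow> real" where
  "fejer x = (sin x / x)\<^sup>2"

lemma fejer_nonneg: "0 \<le> fejer x" by (simp add: fejer_def)

lemma fejer_measurable [measurable]: "fejer \<in> borel_measurable borel"
  unfolding fejer_def by measurable

text \<open>Double-angle and product-to-sum formulas reduce the Fourier integral to three dilates
  covered by \<open>has_bochner_integral_cos_kernel_scale\<close>.\<close>

lemma fejer_cos_eq:
  "fejer x * cos (\<xi> * x) = - (1/2) * ((1 - cos (\<xi> * x)) / x\<^sup>2)
     + 1/4 * ((1 - cos ((2 + \<xi>) * x)) / x\<^sup>2) + 1/4 * ((1 - cos ((2 - \<xi>) * x)) / x\<^sup>2)"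
proof -
  have "(sin x)\<^sup>2 = (1 - cos (2 * x)) / 2" using cos_double_sin[of x] by simp
  then have "(sin x)\<^sup>2 * cos (\<xi> * x) = cos (\<xi> * x) / 2 - cos (2 * x) * cos (\<xi> * x) / 2"
    by (simp add: left_diff_distrib diff_divide_distrib)
  moreover have "cos ((2 + \<xi>) * x) + cos ((2 - \<xi>) * x) = 2 * (cos (2 * x) * cos (\<xi> * x))"
    by (simp add: cos_add cos_diff algebra_simps)
  ultimately have "(sin x)\<^sup>2 * cos (\<xi> * x) = - (1/2) * (1 - cos (\<xi> * x))
     + 1/4 * (1 - cos ((2 + \<xi>) * x)) + 1/4 * (1 - cos ((2 - \<xi>) * x))"
    by argo
  then have "(sin x)\<^sup>2 * cos (\<xi> * x) / x\<^sup>2 = (- (1/2) * (1 - cos (\<xi> * x))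
     + 1/4 * (1 - cos ((2 + \<xi>) * x)) + 1/4 * (1 - cos ((2 - \<xi>) * x))) / x\<^sup>2"
    by (rule arg_cong)
  then show ?thesis
    by (simp only: fejer_def power_divide add_divide_distrib times_divide_eq_left times_divide_eq_right)
qed

text \<open>Scaling alone gives the Fourier transform, up to a constant factor whose value is irrelevant.\<close>

lemma has_bochner_integral_fejer_cos:
  "has_bochner_integral lborel (\<lambda>x. fejer x * cos (\<xi> * x))
     ((- (1/2) * \<bar>\<xi>\<bar> + 1/4 * \<bar>2 + \<xi>\<bar> + 1/4 * \<bar>2 - \<xi>\<bar>) * integral\<^sup>L lborel cos_kernel)"
proof -
  have "has_bochner_integral lborel (\<lambda>x. - (1/2) * ((1 - cos (\<xi> * x)) / x\<^sup>2)
     + 1/4 * ((1 - cos ((2 + \<xi>) * x)) / x\<^sup>2) + 1/4 * ((1 - cos ((2 - \<xi>) * x)) / x\<^sup>2))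
     (- (1/2) * (\<bar>\<xi>\<bar> * integral\<^sup>L lborel cos_kernel) + 1/4 * (\<bar>2 + \<xi>\<bar> * integral\<^sup>L lborel cos_kernel)
       + 1/4 * (\<bar>2 - \<xi>\<bar> * integral\<^sup>L lborel cos_kernel))"
    by (intro has_bochner_integral_add has_bochner_integral_mult_right has_bochner_integral_cos_kernel_scale)
  then show ?thesis unfolding fejer_cos_eq by (simp only: distrib_right mult.assoc)
qed

lemma integrable_fejer: "integrable lborel fejer"
  using has_bochner_integral_fejer_cos[of 0] by (simp add: has_bochner_integral_iff)

lemma integrable_fejer_cis: "integrable lborel (\<lambda>x. complex_of_real (fejer x) * cis (\<xi> * x))"
  by (rule Bochner_Integration.integrable_bound[OF integrable_fejer])
     (auto simp: norm_mult cis_conv_exp)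

lemma integral_fejer_cis_eq_0:
  assumes "2 \<le> \<bar>\<xi>\<bar>"
  shows "(\<integral>x. complex_of_real (fejer x) * cis (\<xi> * x) \<partial>lborel) = 0" (is "?I = 0")
proof (rule complex_eqI)
  have "Re ?I = (\<integral>x. fejer x * cos (\<xi> * x) \<partial>lborel)"
    by (subst integral_Re[symmetric, OF integrable_fejer_cis]) simp
  also have "\<dots> = 0"
  proof -
    \<comment> \<open>Once |\<xi>| is at least 2, |2 + \<xi>| + |2 - \<xi>| = 2 |\<xi>|, and the
      three terms cancel.\<close>
    have "- (1/2) * \<bar>\<xi>\<bar> + 1/4 * \<bar>2 + \<xi>\<bar> + 1/4 * \<bar>2 - \<xi>\<bar> = 0" using assms by argo
    then show ?thesis
      using has_bochner_integral_fejer_cos[of \<xi>] by (simp only: has_bochner_integral_iff mult_zero_left)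
  qed
  finally show "Re ?I = Re 0" by simp
  have "Im ?I = (\<integral>x. fejer x * sin (\<xi> * x) \<partial>lborel)"
    by (subst integral_Im[symmetric, OF integrable_fejer_cis]) simp
  moreover have "(\<integral>x. fejer x * sin (\<xi> * x) \<partial>lborel) = - (\<integral>x. fejer x * sin (\<xi> * x) \<partial>lborel)"
    by (subst lborel_integral_real_affine[of "-1" _ 0]) (simp_all add: fejer_def)
  ultimately show "Im ?I = Im 0" by simp
qed

text \<open>
  \<^term>\<open>fejer\<close> vanishes at the nonzero multiples of \<open>pi\<close> (and at \<open>0\<close>, where the division is by zero);
  adding a translate gives a kernel that is bounded below and still has compactly supported Fourier transform.
\<close>

definition fejer2 :: "real \<Rightarrow> real" where
  "fejer2 x = fejer x + fejer (x - pi/2)"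

lemma fejer2_nonneg: "0 \<le> fejer2 x" by (simp add: fejer2_def fejer_nonneg)

lemma fejer2_measurable [measurable]: "fejer2 \<in> borel_measurable borel"
  unfolding fejer2_def by measurable

lemma integrable_fejer2: "integrable lborel fejer2"
  using integrable_fejer lborel_integrable_real_affine[OF integrable_fejer, of 1 "- pi/2"]
  by (simp add: fejer2_def[abs_def])

lemma integrable_fejer2_cis: "integrable lborel (\<lambda>x. complex_of_real (fejer2 x) * cis (\<xi> * x))"
  by (rule Bochner_Integration.integrable_bound[OF integrable_fejer2])
     (auto simp: norm_mult cis_conv_exp)

lemma integral_fejer2_cis_eq_0:
  assumes "2 \<le> \<bar>\<xi>\<bar>"
  shows "(\<integral>x. complex_of_real (fejer2 x) * cis (\<xi> * x) \<partial>lborel) = 0"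
proof -
  \<comment> \<open>Translating the kernel multiplies its transform by a phase, so the zero set is
    kept.\<close>
  have eq: "complex_of_real (fejer (x - pi/2)) * cis (\<xi> * x)
      = cis (\<xi> * pi/2) * (complex_of_real (fejer (- pi/2 + 1 * x)) * cis (\<xi> * (- pi/2 + 1 * x)))" for x
    by (simp add: cis_mult algebra_simps)
  have "integrable lborel (\<lambda>x. complex_of_real (fejer (x - pi/2)) * cis (\<xi> * x))"
    unfolding eq by (intro integrable_mult_right lborel_integrable_real_affine[OF integrable_fejer_cis]) simp
  moreover have "(\<integral>x. complex_of_real (fejer (x - pi/2)) * cis (\<xi> * x) \<partial>lborel) = 0"
    unfolding eq using lborel_integral_real_affine[of 1 "\<lambda>x. complex_of_real (fejer x) * cis (\<xi> * x)" "-pi/2"]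
      integral_fejer_cis_eq_0[OF assms] by simp
  ultimately show ?thesis
    using integrable_fejer_cis[of \<xi>] integral_fejer_cis_eq_0[OF assms]
    by (simp add: fejer2_def distrib_right)
qed

text \<open>The shift by pi/2 turns sin into -cos, so the two squared numerators add up to
  1.\<close>

lemma fejer2_lower: "1 / (2 + \<bar>x\<bar>)\<^sup>2 \<le> fejer2 x"
proof -
  have *: "(sin y)\<^sup>2 / (2 + \<bar>x\<bar>)\<^sup>2 \<le> fejer y" if "\<bar>y\<bar> \<le> 2 + \<bar>x\<bar>" for y
  proof (cases "y = 0")
    case False
    have "y\<^sup>2 \<le> (2 + \<bar>x\<bar>)\<^sup>2" using power_mono[OF that, of 2] by simp
    then show ?thesis using False
      unfolding fejer_def power_divide by (intro divide_left_mono) auto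
  qed (simp add: fejer_def)
  have "\<bar>x - pi/2\<bar> \<le> 2 + \<bar>x\<bar>" using pi_less_4 pi_gt_zero by linarith
  from *[of x] *[OF this] have "((sin x)\<^sup>2 + (sin (x - pi/2))\<^sup>2) / (2 + \<bar>x\<bar>)\<^sup>2 \<le> fejer2 x"
    by (simp add: fejer2_def add_divide_distrib)
  moreover have "sin (x - pi/2) = - cos x" by (simp add: sin_diff)
  ultimately show ?thesis by simp
qed

text \<open>When the square is expanded, products from two different groups oscillate with frequency
  at least 2 and integrate to 0 against \<open>fejer2\<close>. Inside one group no separation is
  asked for.\<close>

lemma integral_fejer2_orthogonal:
  fixes b :: "'a \<Rightarrow> complex" and \<mu> :: "'a \<Rightarrow> real"
  assumes "finite T" "\<And>k. k \<in> T \<Longrightarrow> finite (S k)"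
    and sep: "\<And>k l a b. k \<in> T \<Longrightarrow> l \<in> T \<Longrightarrow> k \<noteq> l \<Longrightarrow> a \<in> S k \<Longrightarrow> b \<in> S l \<Longrightarrow> 2 \<le> \<bar>\<mu> a - \<mu> b\<bar>"
  defines "h \<equiv> \<lambda>k x. \<Sum>a\<in>S k. b a * cis (\<mu> a * x)"
  shows "(\<integral>x. fejer2 x * (norm (\<Sum>k\<in>T. h k x))\<^sup>2 \<partial>lborel) = (\<Sum>k\<in>T. \<integral>x. fejer2 x * (norm (h k x))\<^sup>2 \<partial>lborel)"
    and "\<And>k. integrable lborel (\<lambda>x. fejer2 x * (norm (h k x))\<^sup>2)"
proof -
  have prod_eq: "complex_of_real (fejer2 x) * (h k x * cnj (h l x))
      = (\<Sum>a\<in>S k. \<Sum>c\<in>S l. (b a * cnj (b c)) * (complex_of_real (fejer2 x) * cis ((\<mu> a - \<mu> c) * x)))" for k l x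
  proof -
    have "cis (\<mu> a * x) * cnj (cis (\<mu> c * x)) = cis ((\<mu> a - \<mu> c) * x)" for a c
      by (simp add: cis_cnj cis_mult left_diff_distrib)
    then have "complex_of_real (fejer2 x) * (b a * cis (\<mu> a * x) * (cnj (b c) * cnj (cis (\<mu> c * x))))
        = (b a * cnj (b c)) * (complex_of_real (fejer2 x) * cis ((\<mu> a - \<mu> c) * x))" for a c
      by (metis mult.assoc mult.left_commute)
    then show ?thesis
      unfolding h_def cnj_sum complex_cnj_mult unfolding sum_product unfolding sum_distrib_left
      by (simp only:)
  qed
  have int: "integrable lborel (\<lambda>x. complex_of_real (fejer2 x) * (h k x * cnj (h l x)))" for k l
    unfolding prod_eq by (intro Bochner_Integration.integrable_sum integrable_mult_right integrable_fejer2_cis)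
  have zero: "(\<integral>x. complex_of_real (fejer2 x) * (h k x * cnj (h l x)) \<partial>lborel) = 0"
    if "k \<in> T" "l \<in> T" "k \<noteq> l" for k l
    unfolding prod_eq
    by (subst Bochner_Integration.integral_sum | intro Bochner_Integration.integrable_sum integrable_mult_right integrable_fejer2_cis sum.neutral ballI)+
       (simp add: integral_fejer2_cis_eq_0 sep[OF that])
  have nsq: "complex_of_real (fejer2 x * (norm u)\<^sup>2) = complex_of_real (fejer2 x) * (u * cnj u)" for x u
    by (simp add: complex_norm_square del: of_real_power)
  show int1: "integrable lborel (\<lambda>x. fejer2 x * (norm (h k x))\<^sup>2)" for k
  proof -
    have "integrable lborel (\<lambda>x. complex_of_real (fejer2 x * (norm (h k x))\<^sup>2))"
      unfolding nsq by (rule int)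
    then show ?thesis by (simp only: complex_of_real_integrable_eq)
  qed
  have "complex_of_real (\<integral>x. fejer2 x * (norm (\<Sum>k\<in>T. h k x))\<^sup>2 \<partial>lborel)
     = (\<integral>x. (\<Sum>k\<in>T. \<Sum>l\<in>T. complex_of_real (fejer2 x) * (h k x * cnj (h l x))) \<partial>lborel)"
    unfolding integral_complex_of_real[symmetric] nsq cnj_sum
    unfolding sum_product unfolding sum_distrib_left ..
  also have "\<dots> = (\<Sum>k\<in>T. \<Sum>l\<in>T. \<integral>x. complex_of_real (fejer2 x) * (h k x * cnj (h l x)) \<partial>lborel)"
    by (simp add: Bochner_Integration.integral_sum int)
  also have "\<dots> = (\<Sum>k\<in>T. \<integral>x. complex_of_real (fejer2 x) * (h k x * cnj (h k x)) \<partial>lborel)"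
  proof (rule sum.cong[OF refl])
    fix k assume "k \<in> T"
    then show "(\<Sum>l\<in>T. \<integral>x. complex_of_real (fejer2 x) * (h k x * cnj (h l x)) \<partial>lborel)
        = (\<integral>x. complex_of_real (fejer2 x) * (h k x * cnj (h k x)) \<partial>lborel)"
      using \<open>finite T\<close> zero by (subst sum.remove[of _ k]) (auto intro!: sum.neutral)
  qed
  also have "\<dots> = complex_of_real (\<Sum>k\<in>T. \<integral>x. fejer2 x * (norm (h k x))\<^sup>2 \<partial>lborel)"
    unfolding nsq[symmetric] integral_complex_of_real of_real_sum ..
  finally show "(\<integral>x. fejer2 x * (norm (\<Sum>k\<in>T. h k x))\<^sup>2 \<partial>lborel) = (\<Sum>k\<in>T. \<integral>x. fejer2 x * (norm (h k x))\<^sup>2 \<partial>lborel)"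
    by (simp only: of_real_eq_iff)
qed

section \<open>Exponential sums over angles\<close>

definition dir :: "real \<Rightarrow> real \<times> real" where
  "dir \<theta> = (cos \<theta>, sin \<theta>)"

lemma norm_dir [simp]: "norm (dir \<theta>) = 1"
  by (simp add: dir_def norm_Pair)

lemma inner_dir_dir: "dir a \<bullet> dir b = cos (a - b)"
  by (simp add: dir_def cos_diff)

text \<open>Arbitrary coefficients let a translation be absorbed as phases
  (\<open>esum_translate\<close>), which leaves \<open>energy\<close> unchanged.\<close>

definition esum :: "real set \<Rightarrow> (real \<Rightarrow> complex) \<Rightarrow> real \<times> real \<Rightarrow> complex" where
  "esum S c z = (\<Sum>\<theta>\<in>S. c \<theta> * cis (2 * pi * (dir \<theta> \<bullet> z)))"

definition energy :: "real set \<Rightarrow> (real \<Rightarrow> complex) \<Rightarrow> real" where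
  "energy S c = (\<Sum>\<theta>\<in>S. (norm (c \<theta>))\<^sup>2)"

lemma energy_nonneg: "0 \<le> energy S c"
  by (simp add: energy_def sum_nonneg)

lemma esum_measurable [measurable]: "esum S c \<in> borel_measurable borel"
  unfolding esum_def cis_conv_exp
  by (intro borel_measurable_continuous_onI continuous_intros)

lemma esum_translate:
  "esum S c (z + v) = esum S (\<lambda>\<theta>. c \<theta> * cis (2 * pi * (dir \<theta> \<bullet> v))) z"
  unfolding esum_def by (simp add: inner_add_right distrib_left cis_mult[symmetric] mult_ac)

lemma energy_translate: "energy S (\<lambda>\<theta>. c \<theta> * cis (u \<theta>)) = energy S c"
  by (simp add: energy_def norm_mult)

lemma energy_eq_0_imp_esum: "finite S \<Longrightarrow> energy S c = 0 \<Longrightarrow> esum S c z = 0"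
  by (simp add: energy_def esum_def sum_nonneg_eq_0_iff)

lemma energy_mono: "finite S \<Longrightarrow> S' \<subseteq> S \<Longrightarrow> energy S' c \<le> energy S c"
  unfolding energy_def by (rule sum_mono2) auto

lemma norm_esum_square_le:
  assumes "finite S" shows "(norm (esum S c z))\<^sup>2 \<le> real (card S) * energy S c"
proof -
  have "norm (esum S c z) \<le> (\<Sum>\<theta>\<in>S. norm (c \<theta>))"
    unfolding esum_def by (rule order_trans[OF norm_sum]) (simp add: norm_mult)
  then have "(norm (esum S c z))\<^sup>2 \<le> (\<Sum>\<theta>\<in>S. 1 * norm (c \<theta>))\<^sup>2"
    by (intro power_mono) auto
  also have "\<dots> \<le> (\<Sum>\<theta>\<in>S. 1\<^sup>2) * (\<Sum>\<theta>\<in>S. (norm (c \<theta>))\<^sup>2)"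
    by (rule Cauchy_Schwarz_ineq_sum)
  finally show ?thesis by (simp add: energy_def)
qed

section \<open>Local constancy by Gaussian averaging\<close>

lemma (in prob_space) powr_expectation_le:
  fixes X :: "'a \<Rightarrow> real"
  assumes "integrable M X" "integrable M (\<lambda>x. X x powr q)" "\<And>x. 0 \<le> X x" "1 < q"
  shows "expectation X powr q \<le> expectation (\<lambda>x. X x powr q)"
proof (cases "expectation X = 0")
  case False
  define m where "m = expectation X"
  have "0 \<le> m" unfolding m_def by (rule Bochner_Integration.integral_nonneg) (rule assms(3))
  with False have m: "0 < m" by (simp add: m_def)
  \<comment> \<open>Jensen's inequality through Young's: this is the tangent line bound for the q-th
    power at the mean m, and taking expectations lets the powers of m combine.\<close>
  have "m powr (q - 1) * X x \<le> X x powr q / q + (1 - 1/q) * m powr q" for x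
  proof -
    have "1 < q / (q - 1)" using assms(4) by (simp add: field_simps)
    moreover have "1 / q + 1 / (q / (q - 1)) = 1" using assms(4) by (simp add: field_simps)
    ultimately have "X x * m powr (q - 1)
        \<le> X x powr q / q + (m powr (q - 1)) powr (q / (q - 1)) / (q / (q - 1))"
      using assms by (intro Youngs_inequality) auto
    moreover have "(m powr (q - 1)) powr (q / (q - 1)) / (q / (q - 1)) = (1 - 1/q) * m powr q"
    proof -
      have "(q - 1) * (q / (q - 1)) = q" using assms(4) by simp
      moreover have "y / (q / (q - 1)) = (1 - 1/q) * y" for y using assms(4) by (simp add: field_simps)
      ultimately show ?thesis by (simp only: powr_powr)
    qed
    ultimately show ?thesis by (simp add: mult.commute)
  qed
  then have "expectation (\<lambda>x. m powr (q - 1) * X x) \<le> expectation (\<lambda>x. X x powr q / q + (1 - 1/q) * m powr q)"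
    using assms by (intro integral_mono) auto
  also have "\<dots> = expectation (\<lambda>x. X x powr q) / q + (1 - 1/q) * m powr q"
    using assms by (simp add: prob_space)
  also have "expectation (\<lambda>x. m powr (q - 1) * X x) = m powr (q - 1) * m powr 1"
    using m by (simp add: m_def)
  also have "\<dots> = m powr q" by (simp only: powr_add[symmetric]) simp
  finally have "m powr q / q \<le> expectation (\<lambda>x. X x powr q) / q" by (simp add: algebra_simps)
  then show ?thesis using assms(4) by (simp add: m_def divide_le_cancel)
qed (use assms in \<open>simp add: Bochner_Integration.integral_nonneg\<close>)

text \<open>
  Averaging over a Gaussian translation multiplies each coefficient by a factor in \<open>[exp (-1/2), 1]\<close>;
  dividing the coefficients by these factors beforehand avoids a kernel with flat Fourier transform.
\<close>

lemma esum_local_constancy: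
  assumes fin: "finite S" and t: "0 < t" and near: "\<And>\<theta>. \<theta> \<in> S \<Longrightarrow> \<bar>\<theta> - \<beta>\<bar> \<le> t" and q: "1 < q"
  obtains c' where "\<And>\<theta>. \<theta> \<in> S \<Longrightarrow> norm (c' \<theta>) \<le> 2 * norm (c \<theta>)"
    and "\<And>z. ennreal (norm (esum S c z) powr q)
        \<le> (\<integral>\<^sup>+\<tau>. ennreal (norm (esum S c' (z + (\<tau> / (pi * t\<^sup>2)) *\<^sub>R dir \<beta>)) powr q) \<partial>std_normal_distribution)"
proof -
  define \<rho> where "\<rho> = pi * t\<^sup>2"
  have \<rho>: "0 < \<rho>" using t by (simp add: \<rho>_def)
  \<comment> \<open>Frequency along \<open>dir \<beta>\<close> once the common carrier 2 pi / \<rho>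
    is removed. The choice of \<rho> makes it at most 1 in absolute value, because 1 - cos is at
    most t^2 / 2.\<close>
  define u where "u \<theta> = 2 * pi * (cos (\<theta> - \<beta>) - 1) / \<rho>" for \<theta>
  define c' where "c' \<theta> = c \<theta> * complex_of_real (exp ((u \<theta>)\<^sup>2 / 2))" for \<theta>
  interpret G: prob_space std_normal_distribution
    by (rule prob_space_normal_density) simp
  have u: "\<bar>u \<theta>\<bar> \<le> 1" if "\<theta> \<in> S" for \<theta>
  proof -
    have "1 - cos (\<theta> - \<beta>) \<le> (\<theta> - \<beta>)\<^sup>2 / 2" by (rule one_minus_cos_le)
    also have "(\<theta> - \<beta>)\<^sup>2 \<le> t\<^sup>2" using near[OF that] t by (metis abs_le_square_iff abs_of_pos)
    finally have "2 * pi * (1 - cos (\<theta> - \<beta>)) \<le> 2 * pi * (t\<^sup>2 / 2)" by (intro mult_left_mono) auto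
    then have "2 * pi * (1 - cos (\<theta> - \<beta>)) \<le> \<rho>" by (simp add: \<rho>_def)
    moreover have "0 \<le> 2 * pi * (1 - cos (\<theta> - \<beta>))" by simp
    moreover have "\<bar>u \<theta>\<bar> = 2 * pi * (1 - cos (\<theta> - \<beta>)) / \<rho>"
      using \<rho> by (simp add: u_def abs_mult abs_divide)
    ultimately show ?thesis using \<rho> by simp
  qed
  show thesis
  proof
    fix \<theta> assume "\<theta> \<in> S"
    have "exp ((u \<theta>)\<^sup>2 / 2) \<le> exp (1/2)" using u[OF \<open>\<theta> \<in> S\<close>] by (simp add: abs_square_le_1)
    also have "\<dots> \<le> (2::real)"
    proof -
      have "exp (1/2 :: real) \<le> 1 + 1/2 + (1/2)\<^sup>2" by (rule exp_bound) auto
      then show ?thesis by (simp add: power2_eq_square)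
    qed
    finally show "norm (c' \<theta>) \<le> 2 * norm (c \<theta>)"
      using mult_left_mono[of "exp ((u \<theta>)\<^sup>2 / 2)" 2 "norm (c \<theta>)"] by (simp add: c'_def norm_mult mult.commute)
  next
    fix z
    define g where "g \<tau> = esum S c' (z + (\<tau> / \<rho>) *\<^sub>R dir \<beta>)" for \<tau>
    define e where "e \<theta> = cis (2 * pi * (dir \<theta> \<bullet> z))" for \<theta>
    have g_meas [measurable]: "g \<in> borel_measurable borel"
      unfolding g_def by measurable
    have g_bound: "norm (g \<tau>) \<le> (\<Sum>\<theta>\<in>S. norm (c' \<theta>))" for \<tau>
      unfolding g_def esum_def by (rule order_trans[OF norm_sum]) (simp add: norm_mult)
    have int_cis: "integrable std_normal_distribution (\<lambda>\<tau>. cis (x * \<tau>))" for x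
      by (rule G.integrable_const_bound[where B=1]) (auto simp: cis_conv_exp)
    have char: "(\<integral>\<tau>. cis (x * \<tau>) \<partial>std_normal_distribution) = complex_of_real (exp (- (x\<^sup>2) / 2))" for x
      using fun_cong[OF char_std_normal_distribution, of x] by (simp add: char_def cis_conv_exp)
    \<comment> \<open>The carrier has modulus 1, so removing it is free. Averaging over \<tau> then
      produces the Gaussian characteristic function at \<open>u \<theta>\<close>, which the factor
      in \<open>c'\<close> cancels.\<close>
    have g_eq: "cis (- 2 * pi / \<rho> * \<tau>) * g \<tau> = (\<Sum>\<theta>\<in>S. (c' \<theta> * e \<theta>) * cis (u \<theta> * \<tau>))" for \<tau>
    proof -
      have "cis (- 2 * pi / \<rho> * \<tau>) * (c' \<theta> * cis (2 * pi * (dir \<theta> \<bullet> (z + (\<tau> / \<rho>) *\<^sub>R dir \<beta>))))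
          = (c' \<theta> * e \<theta>) * cis (u \<theta> * \<tau>)" for \<theta>
      proof -
        have "2 * pi * (dir \<theta> \<bullet> (z + (\<tau> / \<rho>) *\<^sub>R dir \<beta>)) = 2 * pi * (dir \<theta> \<bullet> z) + u \<theta> * \<tau> + 2 * pi / \<rho> * \<tau>"
          using \<rho> by (simp add: inner_add_right inner_dir_dir u_def field_simps)
        then have "cis (2 * pi * (dir \<theta> \<bullet> (z + (\<tau> / \<rho>) *\<^sub>R dir \<beta>))) = e \<theta> * cis (u \<theta> * \<tau>) * cis (2 * pi / \<rho> * \<tau>)"
          by (simp only: e_def cis_mult)
        moreover have "cis (2 * pi / \<rho> * \<tau>) * cis (- 2 * pi / \<rho> * \<tau>) = 1" by (simp add: cis_mult)
        moreover have "x * (c' \<theta> * (y * w * v)) = (c' \<theta> * y) * w * (v * x)" for x y w v :: complex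
          by (simp only: mult_ac)
        ultimately show ?thesis by (simp only: mult_1_right)
      qed
      then show ?thesis by (simp only: g_def esum_def sum_distrib_left)
    qed
    have int_g: "integrable std_normal_distribution (\<lambda>\<tau>. norm (g \<tau>))"
      by (rule G.integrable_const_bound[where B="\<Sum>\<theta>\<in>S. norm (c' \<theta>)"]) (auto simp: g_bound)
    have int_gq: "integrable std_normal_distribution (\<lambda>\<tau>. norm (g \<tau>) powr q)"
      using q by (intro G.integrable_const_bound[where B="(\<Sum>\<theta>\<in>S. norm (c' \<theta>)) powr q"])
        (auto intro!: powr_mono2 simp: g_bound)
    have "esum S c z = (\<Sum>\<theta>\<in>S. (c' \<theta> * e \<theta>) * complex_of_real (exp (- ((u \<theta>)\<^sup>2) / 2)))"
      unfolding esum_def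
    proof (rule sum.cong[OF refl])
      fix \<theta>
      have "complex_of_real (exp ((u \<theta>)\<^sup>2 / 2)) * complex_of_real (exp (- ((u \<theta>)\<^sup>2) / 2)) = 1"
        by (simp flip: of_real_mult exp_add)
      moreover have "(c \<theta> * x * y) * w = c \<theta> * y * (x * w)" for x y w :: complex
        by (simp only: mult_ac)
      ultimately show "c \<theta> * cis (2 * pi * (dir \<theta> \<bullet> z)) = (c' \<theta> * e \<theta>) * complex_of_real (exp (- ((u \<theta>)\<^sup>2) / 2))"
        unfolding c'_def e_def by (simp only: mult_1_right)
    qed
    also have "\<dots> = (\<integral>\<tau>. cis (- 2 * pi / \<rho> * \<tau>) * g \<tau> \<partial>std_normal_distribution)"
      unfolding g_eq by (simp add: Bochner_Integration.integral_sum int_cis char)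
    finally have "norm (esum S c z) \<le> (\<integral>\<tau>. norm (cis (- 2 * pi / \<rho> * \<tau>) * g \<tau>) \<partial>std_normal_distribution)"
      by (metis integral_norm_bound)
    then have "norm (esum S c z) \<le> G.expectation (\<lambda>\<tau>. norm (g \<tau>))" by (simp add: norm_mult)
    then have "norm (esum S c z) powr q \<le> (G.expectation (\<lambda>\<tau>. norm (g \<tau>))) powr q"
      using q by (intro powr_mono2) auto
    also have "\<dots> \<le> G.expectation (\<lambda>\<tau>. norm (g \<tau>) powr q)"
      by (intro G.powr_expectation_le int_g int_gq q) simp
    finally have "ennreal (norm (esum S c z) powr q) \<le> ennreal (G.expectation (\<lambda>\<tau>. norm (g \<tau>) powr q))"
      by (rule ennreal_leI)
    also have "\<dots> = (\<integral>\<^sup>+\<tau>. ennreal (norm (g \<tau>) powr q) \<partial>std_normal_distribution)"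
      by (rule nn_integral_eq_integral[symmetric, OF int_gq]) simp
    finally show "ennreal (norm (esum S c z) powr q)
        \<le> (\<integral>\<^sup>+\<tau>. ennreal (norm (esum S c' (z + (\<tau> / (pi * t\<^sup>2)) *\<^sub>R dir \<beta>)) powr q) \<partial>std_normal_distribution)"
      by (simp add: g_def \<rho>_def)
  qed
qed

text \<open>The Gaussian weights the translates, and \<open>exp (\<bar>x\<bar> / 2)\<close> is the
  price of undoing a translate under the measure. Their product has to be majorised by a kernel with
  compactly supported transform.\<close>

lemma std_normal_density_exp_le_fejer2:
  "std_normal_density x * exp (\<bar>x\<bar> / 2) \<le> 4 * exp (9/8) * fejer2 x"
proof -
  have "1 / sqrt (2 * pi) \<le> 1" using pi_gt3 by simp
  then have "std_normal_density x \<le> 1 * exp (- x\<^sup>2 / 2)"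
    unfolding std_normal_density_def by (intro mult_right_mono) auto
  then have "std_normal_density x * exp (\<bar>x\<bar> / 2) \<le> exp (- x\<^sup>2 / 2) * exp (\<bar>x\<bar> / 2)"
    by (intro mult_right_mono) auto
  also have "\<dots> = exp (- x\<^sup>2 / 2 + \<bar>x\<bar> / 2)" by (simp only: exp_add)
  also have "\<dots> \<le> exp (9/8 - \<bar>x\<bar>)"
  proof -
    \<comment> \<open>Completing the square: 9/8 pays for trading the Gaussian against
      \<open>exp (- \<bar>x\<bar>)\<close>, which decays faster than the quadratic bound in
      \<open>fejer2_lower\<close>.\<close>
    have "0 \<le> (\<bar>x\<bar> - 3/2)\<^sup>2" by simp
    then have "3 * \<bar>x\<bar> \<le> x\<^sup>2 + 9/4" by (simp add: power2_diff power_divide)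
    then have "- x\<^sup>2 / 2 + \<bar>x\<bar> / 2 \<le> 9/8 - \<bar>x\<bar>" by argo
    then show ?thesis by simp
  qed
  also have "\<dots> = exp (9/8) / exp \<bar>x\<bar>" by (simp add: exp_diff)
  also have "\<dots> \<le> 4 * exp (9/8) * (1 / (2 + \<bar>x\<bar>)\<^sup>2)"
  proof -
    have "1 + \<bar>x\<bar> + \<bar>x\<bar>\<^sup>2 / 2 \<le> exp \<bar>x\<bar>" by (rule exp_lower_Taylor_quadratic) simp
    then have "4 * (1 + \<bar>x\<bar> + \<bar>x\<bar>\<^sup>2 / 2) \<le> 4 * exp \<bar>x\<bar>" by simp
    moreover have "(2 + \<bar>x\<bar>)\<^sup>2 \<le> 4 * (1 + \<bar>x\<bar> + \<bar>x\<bar>\<^sup>2 / 2)" by (simp add: power2_sum)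
    ultimately have "(2 + \<bar>x\<bar>)\<^sup>2 \<le> 4 * exp \<bar>x\<bar>" by linarith
    moreover have "0 < (2 + \<bar>x\<bar>)\<^sup>2" by (simp add: add_pos_nonneg)
    ultimately show ?thesis by (simp add: field_simps)
  qed
  also have "\<dots> \<le> 4 * exp (9/8) * fejer2 x"
    by (intro mult_left_mono fejer2_lower) simp
  finally show ?thesis .
qed

text \<open>Transversality: for angles at distance at least d from \<beta>, the projections onto
  \<open>dir \<beta>\<close> separate at a rate proportional to d. The cosine difference is a
  product of two sines, each bounded below linearly.\<close>

lemma abs_cos_diff_ge:
  fixes a b d :: real
  assumes "0 \<le> d" "d \<le> \<bar>a\<bar>" "d \<le> \<bar>b\<bar>" "\<bar>a\<bar> \<le> 1" "\<bar>b\<bar> \<le> 1" "\<bar>a - b\<bar> \<le> d"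
  shows "d * \<bar>a - b\<bar> / 4 \<le> \<bar>cos a - cos b\<bar>"
proof -
  have sin_ge: "x / 2 \<le> sin x" if "0 \<le> x" "x \<le> 1" for x :: real
  proof (cases "x = 0")
    case False
    have "\<exists>y. 0 < y \<and> y < x \<and> sin x - sin 0 = (x - 0) * cos y"
      using that False by (intro MVT2) (auto intro!: derivative_eq_intros)
    then obtain y where y: "0 < y" "y < x" "sin x - sin 0 = (x - 0) * cos y" by blast
    have "1 - y\<^sup>2 / 2 \<le> cos y" using one_minus_cos_le[of y] by simp
    moreover have "y\<^sup>2 \<le> 1" using y that by (simp add: power_le_one)
    ultimately have "1/2 \<le> cos y" by simp
    then have "x * (1/2) \<le> x * cos y" using that by (intro mult_left_mono) auto
    then show ?thesis using y by simp
  qed simp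
  have abs_sin_ge: "\<bar>x\<bar> / 2 \<le> \<bar>sin x\<bar>" if "\<bar>x\<bar> \<le> 1" for x :: real
    using sin_ge[of x] sin_ge[of "-x"] that by (cases "0 \<le> x") auto
  show ?thesis
  proof (cases "d = 0")
    case False
    \<comment> \<open>a and b have the same sign, since opposite signs would make |a - b| at least 2
      d.\<close>
    then have "d \<le> \<bar>(a + b) / 2\<bar>" using assms by argo
    then have "d / 2 \<le> \<bar>sin ((a + b) / 2)\<bar>"
      using abs_sin_ge[of "(a + b) / 2"] assms by argo
    moreover have "\<bar>a - b\<bar> / 4 \<le> \<bar>sin ((b - a) / 2)\<bar>"
      using abs_sin_ge[of "(b - a) / 2"] assms by argo
    ultimately have "d / 2 * (\<bar>a - b\<bar> / 4) \<le> \<bar>sin ((a + b) / 2)\<bar> * \<bar>sin ((b - a) / 2)\<bar>"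
      using assms by (intro mult_mono) auto
    then show ?thesis unfolding cos_diff_cos abs_mult by simp
  qed simp
qed

section \<open>Decoupling of transverse arcs\<close>

definition cells :: "real set \<Rightarrow> real \<Rightarrow> int set" where
  "cells S s = (\<lambda>\<theta>. \<lfloor>\<theta> / s\<rfloor>) ` S"

definition piece :: "real set \<Rightarrow> real \<Rightarrow> int \<Rightarrow> real set" where
  "piece S s k = {\<theta> \<in> S. \<lfloor>\<theta> / s\<rfloor> = k}"

lemma piece_subset: "piece S s k \<subseteq> S" by (auto simp: piece_def)

lemma finite_cells: "finite S \<Longrightarrow> finite (cells S s)" by (simp add: cells_def)

lemma finite_piece: "finite S \<Longrightarrow> finite (piece S s k)" by (simp add: piece_def)

lemma esum_pieces: "finite S \<Longrightarrow> esum S c z = (\<Sum>k\<in>cells S s. esum (piece S s k) c z)"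
  unfolding esum_def cells_def piece_def by (rule sum.image_gen)

lemma energy_pieces: "finite S \<Longrightarrow> energy S c = (\<Sum>k\<in>cells S s. energy (piece S s k) c)"
  unfolding energy_def cells_def piece_def by (rule sum.image_gen)

lemma piece_diam:
  assumes "0 < s" "a \<in> piece S s k" "b \<in> piece S s k" shows "\<bar>a - b\<bar> < s"
proof -
  have "\<bar>a / s - b / s\<bar> < 1" using assms by (simp add: piece_def) linarith
  then show ?thesis using assms(1) by (simp add: diff_divide_distrib[symmetric] abs_divide)
qed

text \<open>Neighbouring cells can hold arbitrarily close points; an index gap of 2 leaves a whole
  cell in between. Hence the splitting by parity and the gap 2 for broad pairs.\<close>

lemma piece_separated:
  assumes "0 < s" "a \<in> piece S s k" "b \<in> piece S s l" "2 \<le> \<bar>k - l\<bar>" shows "s \<le> \<bar>a - b\<bar>"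
proof -
  have "1 \<le> \<bar>a / s - b / s\<bar>" using assms by (simp add: piece_def) linarith
  then show ?thesis using assms(1) by (simp add: diff_divide_distrib[symmetric] abs_divide)
qed

lemma card_cells_le:
  assumes "finite S" "0 < s" "0 \<le> r" and diam: "\<And>a b. a \<in> S \<Longrightarrow> b \<in> S \<Longrightarrow> \<bar>a - b\<bar> \<le> r"
  shows "real (card (cells S s)) \<le> r / s + 2"
proof (cases "S = {}")
  case False
  define a where "a = Min S"
  have a: "a \<in> S" "\<And>b. b \<in> S \<Longrightarrow> a \<le> b" using assms(1) False by (auto simp: a_def)
  have "cells S s \<subseteq> {\<lfloor>a / s\<rfloor>..\<lfloor>(a + r) / s\<rfloor>}"
  proof
    fix k assume "k \<in> cells S s"
    then obtain b where b: "b \<in> S" "k = \<lfloor>b / s\<rfloor>" by (auto simp: cells_def)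
    have "a \<le> b" "b \<le> a + r" using a(2)[OF b(1)] diam[OF b(1) a(1)] by linarith+
    then show "k \<in> {\<lfloor>a / s\<rfloor>..\<lfloor>(a + r) / s\<rfloor>}"
      using assms(2) by (auto simp: b(2) intro!: floor_mono divide_right_mono)
  qed
  then have "card (cells S s) \<le> card {\<lfloor>a / s\<rfloor>..\<lfloor>(a + r) / s\<rfloor>}" by (intro card_mono) auto
  moreover have "\<lfloor>a / s\<rfloor> \<le> \<lfloor>(a + r) / s\<rfloor>" using assms by (intro floor_mono divide_right_mono) auto
  ultimately have "real (card (cells S s)) \<le> real_of_int (\<lfloor>(a + r) / s\<rfloor> + 1 - \<lfloor>a / s\<rfloor>)" by simp
  \<comment> \<open>Counting both end cells costs one and rounding down costs at most one more,
    hence the \<open>+ 2\<close>.\<close>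
  also have "\<dots> \<le> (a + r) / s + 1 - (a / s - 1)" by linarith
  finally show ?thesis by (simp add: add_divide_distrib)
qed (use assms in \<open>simp add: cells_def\<close>)

text \<open>In \<tau> every summand is a character with frequency proportional to the cosine of its
  angle to \<beta>. By \<open>sep\<close> these frequencies are 2 apart for different cells of equal
  parity; treating even and odd cells separately costs the factor 2.\<close>

lemma esum_local_orthogonality:
  assumes fin: "finite S" and s: "0 < s"
    and sep: "\<And>a b. a \<in> S \<Longrightarrow> b \<in> S \<Longrightarrow> s \<le> \<bar>a - b\<bar> \<Longrightarrow> \<rho> / pi \<le> \<bar>cos (a - \<beta>) - cos (b - \<beta>)\<bar>"
    and \<rho>: "0 < \<rho>"
  shows "(\<integral>\<^sup>+\<tau>. ennreal (fejer2 \<tau> * (norm (esum S c (z - (\<tau> / \<rho>) *\<^sub>R dir \<beta>)))\<^sup>2) \<partial>lborel)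
    \<le> 2 * (\<Sum>k\<in>cells S s. \<integral>\<^sup>+\<tau>. ennreal (fejer2 \<tau> * (norm (esum (piece S s k) c (z - (\<tau> / \<rho>) *\<^sub>R dir \<beta>)))\<^sup>2) \<partial>lborel)"
proof -
  define \<mu> where "\<mu> a = - 2 * pi * cos (a - \<beta>) / \<rho>" for a
  define b where "b a = c a * cis (2 * pi * (dir a \<bullet> z))" for a
  define h where "h k \<tau> = (\<Sum>a\<in>piece S s k. b a * cis (\<mu> a * \<tau>))" for k \<tau>
  have esum_eq: "esum (piece S s k) c (z - (\<tau> / \<rho>) *\<^sub>R dir \<beta>) = h k \<tau>" for k \<tau>
    unfolding esum_def h_def
  proof (rule sum.cong[OF refl])
    fix a
    have "2 * pi * (dir a \<bullet> (z - (\<tau> / \<rho>) *\<^sub>R dir \<beta>)) = 2 * pi * (dir a \<bullet> z) + \<mu> a * \<tau>"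
      using \<rho> by (simp add: inner_diff_right inner_dir_dir \<mu>_def field_simps)
    then show "c a * cis (2 * pi * (dir a \<bullet> (z - (\<tau> / \<rho>) *\<^sub>R dir \<beta>))) = b a * cis (\<mu> a * \<tau>)"
      by (simp only: b_def cis_mult[symmetric] mult.assoc)
  qed
  define E where "E = {k \<in> cells S s. even k}"
  define O' where "O' = {k \<in> cells S s. odd k}"
  have fE: "finite E" "finite O'" using finite_cells[OF fin] by (auto simp: E_def O'_def)
  have un: "cells S s = E \<union> O'" "E \<inter> O' = {}" by (auto simp: E_def O'_def)
  have freq: "2 \<le> \<bar>\<mu> x - \<mu> y\<bar>"
    if "x \<in> piece S s k" "y \<in> piece S s l" "k \<noteq> l" "even k = even l" for x y k l
  proof -
    have "2 \<le> \<bar>k - l\<bar>" using that(3,4) by presburger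
    with s that have "s \<le> \<bar>x - y\<bar>" by (intro piece_separated)
    then have "\<rho> / pi \<le> \<bar>cos (x - \<beta>) - cos (y - \<beta>)\<bar>"
      using that by (intro sep) (auto simp: piece_def)
    then have "2 * pi / \<rho> * (\<rho> / pi) \<le> 2 * pi / \<rho> * \<bar>cos (x - \<beta>) - cos (y - \<beta>)\<bar>"
      using \<rho> by (intro mult_left_mono) auto
    moreover have "\<mu> x - \<mu> y = - (2 * pi / \<rho>) * (cos (x - \<beta>) - cos (y - \<beta>))"
      by (simp add: \<mu>_def algebra_simps diff_divide_distrib)
    ultimately show ?thesis using \<rho> by (simp add: abs_mult)
  qed
  \<comment> \<open>With the empty index set the separation condition is vacuous, and the
    integrability conclusion still covers every k.\<close>
  have int: "integrable lborel (\<lambda>\<tau>. fejer2 \<tau> * (norm (h k \<tau>))\<^sup>2)" for k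
    using integral_fejer2_orthogonal(2)[of "{}" "piece S s" \<mu> b] by (simp add: h_def)
  have orth: "(\<integral>\<tau>. fejer2 \<tau> * (norm (\<Sum>k\<in>P. h k \<tau>))\<^sup>2 \<partial>lborel) = (\<Sum>k\<in>P. \<integral>\<tau>. fejer2 \<tau> * (norm (h k \<tau>))\<^sup>2 \<partial>lborel)"
    if "P = E \<or> P = O'" for P
    unfolding h_def
    using that fE fin by (intro integral_fejer2_orthogonal(1)) (auto simp: E_def O'_def finite_piece intro!: freq)
  have intP: "integrable lborel (\<lambda>\<tau>. fejer2 \<tau> * (norm (\<Sum>k\<in>P. h k \<tau>))\<^sup>2)" for P
  proof (rule Bochner_Integration.integrable_bound)
    define B where "B = (\<Sum>k\<in>P. \<Sum>a\<in>piece S s k. norm (b a))"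
    show "integrable lborel (\<lambda>\<tau>. B\<^sup>2 * fejer2 \<tau>)" by (simp add: integrable_fejer2)
    show "(\<lambda>\<tau>. fejer2 \<tau> * (norm (\<Sum>k\<in>P. h k \<tau>))\<^sup>2) \<in> borel_measurable lborel"
      unfolding h_def cis_conv_exp by measurable
    have "norm (h k \<tau>) \<le> (\<Sum>a\<in>piece S s k. norm (b a))" for k \<tau>
      unfolding h_def by (rule order_trans[OF norm_sum]) (simp add: norm_mult)
    then have "norm (\<Sum>k\<in>P. h k \<tau>) \<le> B" for \<tau>
      unfolding B_def by (intro sum_norm_le)
    then have "(norm (\<Sum>k\<in>P. h k \<tau>))\<^sup>2 \<le> B\<^sup>2" for \<tau> by (intro power_mono) auto
    then show "AE \<tau> in lborel. norm (fejer2 \<tau> * (norm (\<Sum>k\<in>P. h k \<tau>))\<^sup>2) \<le> norm (B\<^sup>2 * fejer2 \<tau>)"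
      by (intro always_eventually allI) (simp add: abs_mult fejer2_nonneg mult.commute mult_left_mono)
  qed
  have pt: "fejer2 \<tau> * (norm (\<Sum>k\<in>cells S s. h k \<tau>))\<^sup>2
      \<le> 2 * (fejer2 \<tau> * (norm (\<Sum>k\<in>E. h k \<tau>))\<^sup>2) + 2 * (fejer2 \<tau> * (norm (\<Sum>k\<in>O'. h k \<tau>))\<^sup>2)" for \<tau>
  proof -
    have "(norm (\<Sum>k\<in>cells S s. h k \<tau>))\<^sup>2 \<le> (norm (\<Sum>k\<in>E. h k \<tau>) + norm (\<Sum>k\<in>O'. h k \<tau>))\<^sup>2"
      unfolding un(1) sum.union_disjoint[OF fE un(2)] by (intro power_mono norm_triangle_ineq) auto
    also have "\<dots> \<le> 2 * (norm (\<Sum>k\<in>E. h k \<tau>))\<^sup>2 + 2 * (norm (\<Sum>k\<in>O'. h k \<tau>))\<^sup>2"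
      using sum_squares_bound[of "norm (\<Sum>k\<in>E. h k \<tau>)" "norm (\<Sum>k\<in>O'. h k \<tau>)"] by (simp add: power2_sum)
    finally have "fejer2 \<tau> * (norm (\<Sum>k\<in>cells S s. h k \<tau>))\<^sup>2
        \<le> fejer2 \<tau> * (2 * (norm (\<Sum>k\<in>E. h k \<tau>))\<^sup>2 + 2 * (norm (\<Sum>k\<in>O'. h k \<tau>))\<^sup>2)"
      by (rule mult_left_mono[OF _ fejer2_nonneg])
    then show ?thesis by (simp only: distrib_left mult.left_commute)
  qed
  have "(\<integral>\<^sup>+\<tau>. ennreal (fejer2 \<tau> * (norm (esum S c (z - (\<tau> / \<rho>) *\<^sub>R dir \<beta>)))\<^sup>2) \<partial>lborel)
      = ennreal (\<integral>\<tau>. fejer2 \<tau> * (norm (\<Sum>k\<in>cells S s. h k \<tau>))\<^sup>2 \<partial>lborel)"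
    unfolding esum_pieces[OF fin, of _ _ s] esum_eq
    by (intro nn_integral_eq_integral intP) (simp add: fejer2_nonneg)
  also have "\<dots> \<le> ennreal (2 * (\<Sum>k\<in>cells S s. \<integral>\<tau>. fejer2 \<tau> * (norm (h k \<tau>))\<^sup>2 \<partial>lborel))"
  proof (rule ennreal_leI)
    have "(\<integral>\<tau>. fejer2 \<tau> * (norm (\<Sum>k\<in>cells S s. h k \<tau>))\<^sup>2 \<partial>lborel)
        \<le> (\<integral>\<tau>. 2 * (fejer2 \<tau> * (norm (\<Sum>k\<in>E. h k \<tau>))\<^sup>2) + 2 * (fejer2 \<tau> * (norm (\<Sum>k\<in>O'. h k \<tau>))\<^sup>2) \<partial>lborel)"
      by (intro integral_mono pt intP Bochner_Integration.integrable_add integrable_mult_right)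
    also have "\<dots> = 2 * (\<Sum>k\<in>cells S s. \<integral>\<tau>. fejer2 \<tau> * (norm (h k \<tau>))\<^sup>2 \<partial>lborel)"
      unfolding un(1) sum.union_disjoint[OF fE un(2)] by (simp add: intP orth)
    finally show "(\<integral>\<tau>. fejer2 \<tau> * (norm (\<Sum>k\<in>cells S s. h k \<tau>))\<^sup>2 \<partial>lborel)
        \<le> 2 * (\<Sum>k\<in>cells S s. \<integral>\<tau>. fejer2 \<tau> * (norm (h k \<tau>))\<^sup>2 \<partial>lborel)" .
  qed
  also have "\<dots> = 2 * (\<Sum>k\<in>cells S s. ennreal (\<integral>\<tau>. fejer2 \<tau> * (norm (h k \<tau>))\<^sup>2 \<partial>lborel))"
    by (simp add: ennreal_mult sum_nonneg fejer2_nonneg Bochner_Integration.integral_nonneg sum_ennreal)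
  also have "\<dots> = 2 * (\<Sum>k\<in>cells S s. \<integral>\<^sup>+\<tau>. ennreal (fejer2 \<tau> * (norm (h k \<tau>))\<^sup>2) \<partial>lborel)"
    by (intro arg_cong[where f="(*) 2"] sum.cong refl nn_integral_eq_integral[symmetric] int) (simp add: fejer2_nonneg)
  finally show ?thesis by (simp only: esum_eq)
qed

text \<open>Abstracts a weight adapted to a large square: total mass at most 1, and undoing a
  translation by v costs a factor exponential in its length. It is realised by
  \<open>decay_weight\<close>.\<close>

locale quasi_invariant =
  fixes \<mu> :: "(real \<times> real) measure" and \<kappa> :: real
  assumes sets_mu [measurable_cong]: "sets \<mu> = sets borel"
    and mass: "emeasure \<mu> (space \<mu>) \<le> 1"
    and shift: "\<And>F v. F \<in> borel_measurable borel \<Longrightarrow>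
      (\<integral>\<^sup>+z. F (z + v) \<partial>\<mu>) \<le> ennreal (exp (\<kappa> * norm v)) * (\<integral>\<^sup>+z. F z \<partial>\<mu>)"
begin

lemma finite_measure_mu: "finite_measure \<mu>"
  by (rule finite_measureI) (use mass in \<open>metis ennreal_one_neq_top infinity_ennreal_def neq_top_trans\<close>)

end

text \<open>128 = 2 * 4 * 16: the parity splitting, the majorant of the Gaussian, and the enlarged
  coefficients on the second set. The summand 1 keeps the constant at least 1.\<close>

definition decouple_const :: real where
  "decouple_const = 1 + 128 * exp (9/8) * integral\<^sup>L lborel fejer2"

lemma decouple_const_ge_1: "1 \<le> decouple_const"
  by (simp add: decouple_const_def fejer2_nonneg Bochner_Integration.integral_nonneg)

text \<open>Translations have length |\<tau>| / (pi t^2) at scales t \<ge> \<delta>/2; the bound on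
  \<kappa> makes each cost at most exp (|\<tau>| / 2).\<close>

locale decoupling = quasi_invariant +
  fixes \<delta> p :: real
  assumes \<delta>: "0 < \<delta>" and p: "4 < p" "p < 6" and \<kappa>: "\<kappa> \<le> \<delta>\<^sup>2 / 4"
begin

definition q :: real where "q = p - 2"

lemma q: "2 < q" "q < 4" using p by (auto simp: q_def)

text \<open>A separated set of diameter at most s stands for an arc of length s, without fixing an
  interval.\<close>

definition adm :: "real set \<Rightarrow> real \<Rightarrow> bool" where
  "adm S s \<longleftrightarrow> finite S \<and> (\<forall>a\<in>S. \<forall>b\<in>S. a \<noteq> b \<longrightarrow> \<delta> \<le> \<bar>a - b\<bar>) \<and> (\<forall>a\<in>S. \<forall>b\<in>S. \<bar>a - b\<bar> \<le> s)"

text \<open>Y bounds the p-th power of the ratio between the L^p norm and the l^2 norm of the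
  coefficients. A predicate in place of a supremum avoids questions of finiteness.\<close>

definition lin_bound :: "real \<Rightarrow> real \<Rightarrow> bool" where
  "lin_bound r Y \<longleftrightarrow> (\<forall>S c. adm S r \<longrightarrow>
     (\<integral>\<^sup>+z. ennreal (norm (esum S c z) powr p) \<partial>\<mu>) \<le> ennreal (Y * energy S c powr (p/2)))"

text \<open>Asymmetric on purpose: orthogonality acts on S, which has exponent 2, and local
  constancy on T, which has exponent q. Distances at most 1 keep the sines in
  \<open>abs_cos_diff_ge\<close> comparable to their arguments.\<close>

definition bil_bound :: "real \<Rightarrow> real \<Rightarrow> real \<Rightarrow> real \<Rightarrow> bool" where
  "bil_bound d s t X \<longleftrightarrow> (\<forall>S T c e. adm S s \<longrightarrow> adm T t \<longrightarrow> (\<forall>a\<in>S. \<forall>b\<in>T. d \<le> \<bar>a - b\<bar> \<and> \<bar>a - b\<bar> \<le> 1) \<longrightarrow>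
     (\<integral>\<^sup>+z. ennreal ((norm (esum S c z))\<^sup>2 * norm (esum T e z) powr q) \<partial>\<mu>)
       \<le> ennreal (X * energy S c * energy T e powr (q/2)))"

lemma admI:
  assumes "finite S" "\<And>a b. a \<in> S \<Longrightarrow> b \<in> S \<Longrightarrow> a \<noteq> b \<Longrightarrow> \<delta> \<le> \<bar>a - b\<bar>"
    and "\<And>a b. a \<in> S \<Longrightarrow> b \<in> S \<Longrightarrow> \<bar>a - b\<bar> \<le> s"
  shows "adm S s"
  using assms by (simp add: adm_def)

lemma admD:
  assumes "adm S s"
  shows "finite S" "a \<in> S \<Longrightarrow> b \<in> S \<Longrightarrow> a \<noteq> b \<Longrightarrow> \<delta> \<le> \<bar>a - b\<bar>"
    and "a \<in> S \<Longrightarrow> b \<in> S \<Longrightarrow> \<bar>a - b\<bar> \<le> s"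
  using assms by (simp_all add: adm_def)

lemma adm_subset:
  assumes "adm S s" "S' \<subseteq> S" shows "adm S' s"
  using assms(2) by (intro admI finite_subset[OF _ admD(1)[OF assms(1)]] admD(2,3)[OF assms(1)]) (auto dest: subsetD)

lemma adm_mono:
  assumes "adm S s" "s \<le> s'" shows "adm S s'"
  using assms(2) by (intro admI admD(1,2)[OF assms(1)] order_trans[OF admD(3)[OF assms(1)]])

lemma adm_piece:
  assumes "adm S r" "0 < s" shows "adm (piece S s k) s"
  by (intro admI admD(1,2)[OF adm_subset[OF assms(1) piece_subset]] less_imp_le piece_diam[OF assms(2)])

lemma bil_boundD:
  assumes "bil_bound d s t X" "adm S s" "adm T t" "\<And>a b. a \<in> S \<Longrightarrow> b \<in> T \<Longrightarrow> d \<le> \<bar>a - b\<bar> \<and> \<bar>a - b\<bar> \<le> 1"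
  shows "(\<integral>\<^sup>+z. ennreal ((norm (esum S c z))\<^sup>2 * norm (esum T e z) powr q) \<partial>\<mu>)
       \<le> ennreal (X * energy S c * energy T e powr (q/2))"
  using assms(1)[unfolded bil_bound_def, rule_format, OF assms(2,3)] assms(4) by simp

text \<open>
  The Gaussian translation produced by local constancy of the sum over \<open>T\<close> is moved to the sum over \<open>S\<close>,
  where the Gaussian is majorised by \<^term>\<open>fejer2\<close> and the cells of equal parity become orthogonal.
\<close>

lemma bil_bound_decouple:
  assumes bil: "bil_bound d s t X" and X: "0 \<le> X" and d: "0 < d" and t: "\<delta> / 2 \<le> t" and s: "4 * t\<^sup>2 / d \<le> s"
  shows "bil_bound d d t (decouple_const * X)"
  unfolding bil_bound_def
proof (intro allI impI)
  fix S T c e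
  assume S: "adm S d" and T: "adm T t" and ST: "\<forall>a\<in>S. \<forall>b\<in>T. d \<le> \<bar>a - b\<bar> \<and> \<bar>a - b\<bar> \<le> 1"
  have t0: "0 < t" using t \<delta> by simp
  have s0: "0 < s" using s t0 d by (smt (verit) divide_pos_pos zero_less_power)
  define \<rho> where "\<rho> = pi * t\<^sup>2"
  have \<rho>: "0 < \<rho>" using t0 by (simp add: \<rho>_def)
  show "(\<integral>\<^sup>+z. ennreal ((norm (esum S c z))\<^sup>2 * norm (esum T e z) powr q) \<partial>\<mu>)
       \<le> ennreal (decouple_const * X * energy S c * energy T e powr (q/2))"
  proof (cases "T = {}")
    case False
    then obtain \<beta> where \<beta>: "\<beta> \<in> T" by auto
    have finS: "finite S" and finT: "finite T" using S T by (auto simp: adm_def)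
    have near: "\<bar>\<theta> - \<beta>\<bar> \<le> t" if "\<theta> \<in> T" for \<theta> using T \<beta> that by (auto simp: adm_def)
    have "1 < q" using q by simp
    from esum_local_constancy[OF finT t0 near this, of e, folded \<rho>_def]
    obtain e' where e': "\<And>\<theta>. \<theta> \<in> T \<Longrightarrow> norm (e' \<theta>) \<le> 2 * norm (e \<theta>)"
      and lc: "\<And>z. ennreal (norm (esum T e z) powr q)
        \<le> (\<integral>\<^sup>+\<tau>. ennreal (norm (esum T e' (z + (\<tau> / \<rho>) *\<^sub>R dir \<beta>)) powr q) \<partial>std_normal_distribution)"
      by blast
    interpret G: prob_space std_normal_distribution by (rule prob_space_normal_density) simp
    interpret mu: finite_measure \<mu> by (rule finite_measure_mu)
    interpret P: pair_sigma_finite std_normal_distribution \<mu> by unfold_locales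
    interpret P': pair_sigma_finite lborel \<mu> by unfold_locales
    define v where "v \<tau> = (\<tau> / \<rho>) *\<^sub>R dir \<beta>" for \<tau>
    have [measurable]: "v \<in> borel_measurable borel" unfolding v_def by measurable
    \<comment> \<open>Arranged so that \<open>F S \<tau> (z + v \<tau>)\<close> has the sum over S
      at z and the sum over T at \<open>z + v \<tau>\<close>; undoing the shift under the measure
      moves it onto S.\<close>
    define F where "F S' \<tau> z = ennreal ((norm (esum S' c (z - v \<tau>)))\<^sup>2 * norm (esum T e' z) powr q)" for S' \<tau> z
    have [measurable]: "F S' \<tau> \<in> borel_measurable borel" for S' \<tau> unfolding F_def by measurable
    have [measurable]: "(\<lambda>(\<tau>, z). F S' \<tau> z) \<in> borel_measurable (borel \<Otimes>\<^sub>M borel)" for S' unfolding F_def by measurable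
    define C2 :: real where "C2 = 4 * exp (9/8)"
    have C2: "0 \<le> C2" by (simp add: C2_def)
    define H where "H S' = (\<integral>\<^sup>+\<tau>. ennreal (C2 * fejer2 \<tau>) * (\<integral>\<^sup>+z. F S' \<tau> z \<partial>\<mu>) \<partial>lborel)" for S'
    have "(\<integral>\<^sup>+z. ennreal ((norm (esum S c z))\<^sup>2 * norm (esum T e z) powr q) \<partial>\<mu>)
       \<le> (\<integral>\<^sup>+z. (\<integral>\<^sup>+\<tau>. F S \<tau> (z + v \<tau>) \<partial>std_normal_distribution) \<partial>\<mu>)"
    proof (rule nn_integral_mono)
      fix z
      have "ennreal ((norm (esum S c z))\<^sup>2 * norm (esum T e z) powr q)
          \<le> ennreal ((norm (esum S c z))\<^sup>2) * (\<integral>\<^sup>+\<tau>. ennreal (norm (esum T e' (z + v \<tau>)) powr q) \<partial>std_normal_distribution)"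
        by (subst ennreal_mult) (auto intro!: mult_left_mono lc simp: v_def)
      also have "\<dots> = (\<integral>\<^sup>+\<tau>. F S \<tau> (z + v \<tau>) \<partial>std_normal_distribution)"
        by (subst nn_integral_cmult[symmetric]) (auto simp: F_def ennreal_mult)
      finally show "ennreal ((norm (esum S c z))\<^sup>2 * norm (esum T e z) powr q)
          \<le> (\<integral>\<^sup>+\<tau>. F S \<tau> (z + v \<tau>) \<partial>std_normal_distribution)" .
    qed
    also have "\<dots> = (\<integral>\<^sup>+\<tau>. (\<integral>\<^sup>+z. F S \<tau> (z + v \<tau>) \<partial>\<mu>) \<partial>std_normal_distribution)"
      by (rule P.Fubini') (unfold F_def, measurable)
    also have "\<dots> \<le> (\<integral>\<^sup>+\<tau>. ennreal (exp (\<bar>\<tau>\<bar> / 2)) * (\<integral>\<^sup>+z. F S \<tau> z \<partial>\<mu>) \<partial>std_normal_distribution)"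
    proof (rule nn_integral_mono)
      fix \<tau>
      have "(\<integral>\<^sup>+z. F S \<tau> (z + v \<tau>) \<partial>\<mu>) \<le> ennreal (exp (\<kappa> * norm (v \<tau>))) * (\<integral>\<^sup>+z. F S \<tau> z \<partial>\<mu>)"
        by (rule shift) measurable
      also have "\<dots> \<le> ennreal (exp (\<bar>\<tau>\<bar> / 2)) * (\<integral>\<^sup>+z. F S \<tau> z \<partial>\<mu>)"
      proof (intro mult_right_mono ennreal_leI)
        have "(\<delta> / 2)\<^sup>2 \<le> t\<^sup>2" using t \<delta> by (intro power_mono) auto
        then have "2 * \<kappa> \<le> 2 * t\<^sup>2" using \<kappa> by (simp add: power2_eq_square)
        also have "\<dots> \<le> \<rho>" unfolding \<rho>_def using pi_gt3 by (intro mult_right_mono) auto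
        finally have "\<kappa> / \<rho> \<le> 1 / 2" using \<rho> by (simp add: field_simps)
        then have "\<kappa> / \<rho> * \<bar>\<tau>\<bar> \<le> 1 / 2 * \<bar>\<tau>\<bar>" by (intro mult_right_mono) auto
        then show "exp (\<kappa> * norm (v \<tau>)) \<le> exp (\<bar>\<tau>\<bar> / 2)" using \<rho> by (simp add: v_def)
      qed simp
      finally show "(\<integral>\<^sup>+z. F S \<tau> (z + v \<tau>) \<partial>\<mu>) \<le> ennreal (exp (\<bar>\<tau>\<bar> / 2)) * (\<integral>\<^sup>+z. F S \<tau> z \<partial>\<mu>)" .
    qed
    also have "\<dots> = (\<integral>\<^sup>+\<tau>. ennreal (std_normal_density \<tau>) * (ennreal (exp (\<bar>\<tau>\<bar> / 2)) * (\<integral>\<^sup>+z. F S \<tau> z \<partial>\<mu>)) \<partial>lborel)"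
      by (rule nn_integral_density) measurable
    also have "\<dots> \<le> H S"
      unfolding H_def
    proof (rule nn_integral_mono)
      fix \<tau>
      show "ennreal (std_normal_density \<tau>) * (ennreal (exp (\<bar>\<tau>\<bar> / 2)) * (\<integral>\<^sup>+z. F S \<tau> z \<partial>\<mu>)) \<le> ennreal (C2 * fejer2 \<tau>) * (\<integral>\<^sup>+z. F S \<tau> z \<partial>\<mu>)"
        unfolding mult.assoc[symmetric]
        by (intro mult_right_mono)
           (use std_normal_density_exp_le_fejer2[of \<tau>] in \<open>auto simp: C2_def ennreal_mult[symmetric] intro!: ennreal_leI\<close>)
    qed
    \<comment> \<open>After Tonelli, z is fixed and the sum over T is constant in \<tau>, so
      orthogonality applies to the inner integral.\<close>
    also have "H S \<le> 2 * (\<Sum>k\<in>cells S s. H (piece S s k))"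
    proof -
      have swap: "H S' = (\<integral>\<^sup>+z. ennreal (C2 * norm (esum T e' z) powr q) *
          (\<integral>\<^sup>+\<tau>. ennreal (fejer2 \<tau> * (norm (esum S' c (z - v \<tau>)))\<^sup>2) \<partial>lborel) \<partial>\<mu>)" for S'
      proof -
        have "H S' = (\<integral>\<^sup>+\<tau>. (\<integral>\<^sup>+z. ennreal (C2 * fejer2 \<tau>) * F S' \<tau> z \<partial>\<mu>) \<partial>lborel)"
          unfolding H_def by (intro nn_integral_cong nn_integral_cmult[symmetric]) measurable
        also have "\<dots> = (\<integral>\<^sup>+z. (\<integral>\<^sup>+\<tau>. ennreal (C2 * fejer2 \<tau>) * F S' \<tau> z \<partial>lborel) \<partial>\<mu>)"
          by (rule P'.Fubini'[symmetric]) (unfold F_def, measurable)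
        also have "\<dots> = (\<integral>\<^sup>+z. ennreal (C2 * norm (esum T e' z) powr q) *
          (\<integral>\<^sup>+\<tau>. ennreal (fejer2 \<tau> * (norm (esum S' c (z - v \<tau>)))\<^sup>2) \<partial>lborel) \<partial>\<mu>)"
          by (intro nn_integral_cong, subst nn_integral_cmult[symmetric], measurable)
             (auto simp: F_def ennreal_mult[symmetric] C2 fejer2_nonneg mult_ac intro!: nn_integral_cong)
        finally show ?thesis .
      qed
      have "H S \<le> (\<integral>\<^sup>+z. ennreal (C2 * norm (esum T e' z) powr q) *
          (2 * (\<Sum>k\<in>cells S s. \<integral>\<^sup>+\<tau>. ennreal (fejer2 \<tau> * (norm (esum (piece S s k) c (z - v \<tau>)))\<^sup>2) \<partial>lborel)) \<partial>\<mu>)"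
        unfolding swap v_def
      proof (intro nn_integral_mono mult_left_mono esum_local_orthogonality[OF finS s0 _ \<rho>])
        fix a b assume ab: "a \<in> S" "b \<in> S" "s \<le> \<bar>a - b\<bar>"
        have "\<bar>a - b\<bar> \<le> d" using S ab by (auto simp: adm_def)
        then have "d * \<bar>(a - \<beta>) - (b - \<beta>)\<bar> / 4 \<le> \<bar>cos (a - \<beta>) - cos (b - \<beta>)\<bar>"
          using ST ab \<beta> d by (intro abs_cos_diff_ge) auto
        \<comment> \<open>\<rho> / pi is t^2, so this is the condition that cells have length at
          least 4 t^2 / d.\<close>
        moreover have "\<rho> / pi \<le> d * s / 4" using s d by (simp add: \<rho>_def field_simps)
        moreover have "d * s \<le> d * \<bar>(a - \<beta>) - (b - \<beta>)\<bar>" using d ab by (intro mult_left_mono) auto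
        ultimately show "\<rho> / pi \<le> \<bar>cos (a - \<beta>) - cos (b - \<beta>)\<bar>" by linarith
      qed simp
      also have "\<dots> = 2 * (\<Sum>k\<in>cells S s. H (piece S s k))"
      proof -
        define G where "G k z = (\<integral>\<^sup>+\<tau>. ennreal (fejer2 \<tau> * (norm (esum (piece S s k) c (z - v \<tau>)))\<^sup>2) \<partial>lborel)" for k z
        have [measurable]: "G k \<in> borel_measurable borel" for k unfolding G_def by measurable
        have "(\<integral>\<^sup>+z. ennreal (C2 * norm (esum T e' z) powr q) * (2 * (\<Sum>k\<in>cells S s. G k z)) \<partial>\<mu>)
            = (\<integral>\<^sup>+z. 2 * (\<Sum>k\<in>cells S s. ennreal (C2 * norm (esum T e' z) powr q) * G k z) \<partial>\<mu>)"
          by (intro nn_integral_cong) (simp add: sum_distrib_left mult.left_commute)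
        also have "\<dots> = 2 * (\<integral>\<^sup>+z. (\<Sum>k\<in>cells S s. ennreal (C2 * norm (esum T e' z) powr q) * G k z) \<partial>\<mu>)"
          by (rule nn_integral_cmult) measurable
        also have "(\<integral>\<^sup>+z. (\<Sum>k\<in>cells S s. ennreal (C2 * norm (esum T e' z) powr q) * G k z) \<partial>\<mu>)
            = (\<Sum>k\<in>cells S s. \<integral>\<^sup>+z. ennreal (C2 * norm (esum T e' z) powr q) * G k z \<partial>\<mu>)"
          by (rule nn_integral_sum) measurable
        finally show ?thesis by (simp only: swap G_def)
      qed
      finally show ?thesis .
    qed
    also have "\<dots> \<le> 2 * (\<Sum>k\<in>cells S s. ennreal (C2 * integral\<^sup>L lborel fejer2 * (X * energy (piece S s k) c * (16 * energy T e powr (q/2)))))"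
    proof (intro mult_left_mono sum_mono)
      fix k assume "k \<in> cells S s"
      \<comment> \<open>Doubled coefficients multiply the energy by at most 4, and q/2 \<le> 2 turns
        this into 16.\<close>
      have "energy T e' \<le> 4 * energy T e"
        unfolding energy_def sum_distrib_left
      proof (rule sum_mono)
        fix \<theta> assume "\<theta> \<in> T"
        from power_mono[OF e'[OF this], of 2] show "(norm (e' \<theta>))\<^sup>2 \<le> 4 * (norm (e \<theta>))\<^sup>2"
          by (simp add: power_mult_distrib)
      qed
      then have "energy T e' powr (q/2) \<le> (4 * energy T e) powr (q/2)"
        using q by (intro powr_mono2) (auto simp: energy_nonneg)
      also have "\<dots> = 4 powr (q/2) * energy T e powr (q/2)" by (simp add: powr_mult energy_nonneg)
      also have "(4::real) powr (q/2) \<le> 4 powr 2" using q by (intro powr_mono) auto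
      finally have en: "energy T e' powr (q/2) \<le> 16 * energy T e powr (q/2)" by (simp add: mult_right_mono)
      have "(\<integral>\<^sup>+z. F (piece S s k) \<tau> z \<partial>\<mu>) \<le> ennreal (X * energy (piece S s k) c * (16 * energy T e powr (q/2)))" for \<tau>
      proof -
        \<comment> \<open>The translate becomes a change of phases with the same energy, so
          \<open>bil\<close> applies uniformly in \<tau>.\<close>
        have "esum (piece S s k) c (z - v \<tau>) = esum (piece S s k) (\<lambda>\<theta>. c \<theta> * cis (2 * pi * (dir \<theta> \<bullet> - v \<tau>))) z" for z
          using esum_translate[of "piece S s k" c z "- v \<tau>"] by simp
        then have "(\<integral>\<^sup>+z. F (piece S s k) \<tau> z \<partial>\<mu>)
            \<le> ennreal (X * energy (piece S s k) (\<lambda>\<theta>. c \<theta> * cis (2 * pi * (dir \<theta> \<bullet> - v \<tau>))) * energy T e' powr (q/2))"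
          unfolding F_def using ST piece_subset[of S s k]
          by (simp only:) (intro bil_boundD[OF bil adm_piece[OF S s0] T], blast)
        also have "\<dots> \<le> ennreal (X * energy (piece S s k) c * (16 * energy T e powr (q/2)))"
          unfolding energy_translate using en X by (intro ennreal_leI mult_left_mono) (auto simp: energy_nonneg)
        finally show ?thesis .
      qed
      then have "H (piece S s k) \<le> (\<integral>\<^sup>+\<tau>. ennreal (C2 * fejer2 \<tau>) * ennreal (X * energy (piece S s k) c * (16 * energy T e powr (q/2))) \<partial>lborel)"
        unfolding H_def by (intro nn_integral_mono mult_left_mono) auto
      also have "\<dots> = (\<integral>\<^sup>+\<tau>. ennreal (C2 * fejer2 \<tau>) \<partial>lborel) * ennreal (X * energy (piece S s k) c * (16 * energy T e powr (q/2)))"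
        by (rule nn_integral_multc) measurable
      also have "(\<integral>\<^sup>+\<tau>. ennreal (C2 * fejer2 \<tau>) \<partial>lborel) = ennreal (C2 * integral\<^sup>L lborel fejer2)"
        by (subst nn_integral_eq_integral) (auto simp: integrable_fejer2 fejer2_nonneg C2)
      also have "\<dots> * ennreal (X * energy (piece S s k) c * (16 * energy T e powr (q/2)))
         = ennreal (C2 * integral\<^sup>L lborel fejer2 * (X * energy (piece S s k) c * (16 * energy T e powr (q/2))))"
        by (subst ennreal_mult) (auto simp: C2 X energy_nonneg fejer2_nonneg Bochner_Integration.integral_nonneg)
      finally show "H (piece S s k) \<le> \<dots>" .
    qed simp
    also have "\<dots> = ennreal (2 * (\<Sum>k\<in>cells S s. C2 * integral\<^sup>L lborel fejer2 * (X * energy (piece S s k) c * (16 * energy T e powr (q/2)))))"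
      using C2 X by (subst sum_ennreal) (auto simp: ennreal_mult energy_nonneg fejer2_nonneg Bochner_Integration.integral_nonneg sum_nonneg)
    also have "\<dots> = ennreal (128 * exp (9/8) * integral\<^sup>L lborel fejer2 * X * energy S c * energy T e powr (q/2))"
      unfolding energy_pieces[OF finS, of c s] by (simp add: C2_def sum_distrib_left sum_distrib_right mult_ac)
    also have "\<dots> \<le> ennreal (decouple_const * X * energy S c * energy T e powr (q/2))"
      unfolding decouple_const_def using X by (intro ennreal_leI mult_right_mono) (auto simp: energy_nonneg)
    finally show ?thesis .
  qed (use q in \<open>simp add: esum_def\<close>)
qed

end

section \<open>Interpolation and the broad-narrow recursion\<close>

lemma nn_integral_sum_le:
  assumes "finite I" and [measurable]: "\<And>i. i \<in> I \<Longrightarrow> g i \<in> borel_measurable M"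
    and "\<And>i z. i \<in> I \<Longrightarrow> 0 \<le> g i z" "\<And>i. i \<in> I \<Longrightarrow> 0 \<le> b i"
    and "\<And>i. i \<in> I \<Longrightarrow> (\<integral>\<^sup>+z. ennreal (g i z) \<partial>M) \<le> ennreal (b i)"
  shows "(\<integral>\<^sup>+z. ennreal (\<Sum>i\<in>I. g i z) \<partial>M) \<le> ennreal (\<Sum>i\<in>I. b i)"
proof -
  have "(\<integral>\<^sup>+z. ennreal (\<Sum>i\<in>I. g i z) \<partial>M) = (\<integral>\<^sup>+z. (\<Sum>i\<in>I. ennreal (g i z)) \<partial>M)"
    using assms by (simp add: sum_ennreal)
  also have "\<dots> = (\<Sum>i\<in>I. \<integral>\<^sup>+z. ennreal (g i z) \<partial>M)" by (rule nn_integral_sum) measurable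
  also have "\<dots> \<le> (\<Sum>i\<in>I. ennreal (b i))" using assms by (intro sum_mono)
  also have "\<dots> = ennreal (\<Sum>i\<in>I. b i)" using assms by (simp add: sum_ennreal)
  finally show ?thesis .
qed

lemma nn_integral_cmult_le:
  assumes [measurable]: "g \<in> borel_measurable M" and "0 \<le> a" "0 \<le> b"
    and "(\<integral>\<^sup>+z. ennreal (g z) \<partial>M) \<le> ennreal b"
  shows "(\<integral>\<^sup>+z. ennreal (a * g z) \<partial>M) \<le> ennreal (a * b)"
proof -
  have "(\<integral>\<^sup>+z. ennreal (a * g z) \<partial>M) = ennreal a * (\<integral>\<^sup>+z. ennreal (g z) \<partial>M)"
    using assms(2) by (simp add: ennreal_mult' nn_integral_cmult)
  also have "\<dots> \<le> ennreal a * ennreal b" using assms by (intro mult_left_mono) auto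
  finally show ?thesis using assms by (simp add: ennreal_mult)
qed

lemma nn_integral_add_le:
  assumes [measurable]: "g \<in> borel_measurable M" "h \<in> borel_measurable M"
    and "\<And>z. 0 \<le> g z" "\<And>z. 0 \<le> h z" "0 \<le> a" "0 \<le> b"
    and "(\<integral>\<^sup>+z. ennreal (g z) \<partial>M) \<le> ennreal a" "(\<integral>\<^sup>+z. ennreal (h z) \<partial>M) \<le> ennreal b"
  shows "(\<integral>\<^sup>+z. ennreal (g z + h z) \<partial>M) \<le> ennreal (a + b)"
  using assms by (simp add: ennreal_plus nn_integral_add add_mono)

text \<open>w is at most N times the largest term, whose power is one of the summands on the
  right.\<close>

lemma powr_le_card_powr_sum:
  fixes v :: "'a \<Rightarrow> real"
  assumes "finite I" "\<And>k. k \<in> I \<Longrightarrow> 0 \<le> v k" "0 \<le> w" "w \<le> (\<Sum>k\<in>I. v k)" "real (card I) \<le> N" "0 < q"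
  shows "w powr q \<le> N powr q * (\<Sum>k\<in>I. v k powr q)"
proof (cases "I = {}")
  case False
  define M where "M = Max (v ` I)"
  have "M \<in> v ` I" unfolding M_def using assms(1) False by (intro Max_in) auto
  then obtain k where k: "k \<in> I" "v k = M" by blast
  have M: "v l \<le> v k" if "l \<in> I" for l using that assms(1) k by (simp add: M_def)
  have "w \<le> real (card I) * v k" using assms(4) sum_bounded_above[of I v "v k"] M by simp
  also have "\<dots> \<le> N * v k" using assms k by (intro mult_right_mono) auto
  finally have "w powr q \<le> (N * v k) powr q" using assms by (intro powr_mono2) auto
  also have "\<dots> = N powr q * v k powr q" using assms k by (simp add: powr_mult)
  also have "\<dots> \<le> N powr q * (\<Sum>k\<in>I. v k powr q)"
    using k assms by (intro mult_left_mono member_le_sum) auto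
  finally show ?thesis .
qed (use assms in auto)

text \<open>Let v k be the largest value. Narrow case: every cell that is neither k nor a neighbour
  has value at most v k / N, and w is at most 4 v k. Broad case: some such cell l exceeds v k / N,
  and the pair k, l alone controls w up to powers of N.\<close>

lemma broad_narrow:
  fixes v :: "int \<Rightarrow> real"
  assumes fin: "finite I" and v: "\<And>k. k \<in> I \<Longrightarrow> 0 \<le> v k" and w: "0 \<le> w" "w \<le> (\<Sum>k\<in>I. v k)"
    and N: "real (card I) \<le> N" "1 \<le> N" and p: "0 < q" "q \<le> 4"
  shows "w powr (q + 2) \<le> 4 ^ 6 * (\<Sum>k\<in>I. v k powr (q + 2))
    + N ^ 10 * (\<Sum>k\<in>I. \<Sum>l\<in>{l \<in> I. 2 \<le> \<bar>k - l\<bar>}. (v k)\<^sup>2 * v l powr q)"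
    (is "_ \<le> 4 ^ 6 * ?A + N ^ 10 * ?B")
proof (cases "I = {}")
  case False
  have A0: "0 \<le> ?A" by (simp add: sum_nonneg)
  have B0: "0 \<le> ?B" by (simp add: sum_nonneg)
  define M where "M = Max (v ` I)"
  have "M \<in> v ` I" unfolding M_def using fin False by (intro Max_in) auto
  then obtain k where k: "k \<in> I" "v k = M" by blast
  have M: "v l \<le> v k" if "l \<in> I" for l using that fin k by (simp add: M_def)
  show ?thesis
  proof (cases "\<forall>l\<in>{l \<in> I. 2 \<le> \<bar>k - l\<bar>}. v l \<le> v k / N")
    case True
    have split: "I = {l \<in> I. \<not> 2 \<le> \<bar>k - l\<bar>} \<union> {l \<in> I. 2 \<le> \<bar>k - l\<bar>}" by auto
    have "{l \<in> I. \<not> 2 \<le> \<bar>k - l\<bar>} \<subseteq> {k - 1..k + 1}" by auto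
    then have "card {l \<in> I. \<not> 2 \<le> \<bar>k - l\<bar>} \<le> card {k - 1..k + 1}" by (intro card_mono) auto
    \<comment> \<open>The 4 in the narrow bound is 3 for k and its two neighbours plus 1 for all
      remaining cells together.\<close>
    then have c3: "real (card {l \<in> I. \<not> 2 \<le> \<bar>k - l\<bar>}) \<le> 3" by simp
    have "(\<Sum>l\<in>{l \<in> I. \<not> 2 \<le> \<bar>k - l\<bar>}. v l) \<le> real (card {l \<in> I. \<not> 2 \<le> \<bar>k - l\<bar>}) * v k"
      using M by (intro sum_bounded_above) auto
    also have "\<dots> \<le> 3 * v k" using c3 v[OF k(1)] by (intro mult_right_mono)
    finally have 1: "(\<Sum>l\<in>{l \<in> I. \<not> 2 \<le> \<bar>k - l\<bar>}. v l) \<le> 3 * v k" .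
    have "(\<Sum>l\<in>{l \<in> I. 2 \<le> \<bar>k - l\<bar>}. v l) \<le> real (card {l \<in> I. 2 \<le> \<bar>k - l\<bar>}) * (v k / N)"
      using True by (intro sum_bounded_above) auto
    also have "\<dots> \<le> N * (v k / N)"
    proof (intro mult_right_mono)
      have "card {l \<in> I. 2 \<le> \<bar>k - l\<bar>} \<le> card I" using fin by (intro card_mono) auto
      then show "real (card {l \<in> I. 2 \<le> \<bar>k - l\<bar>}) \<le> N" using N by linarith
    qed (use v[OF k(1)] N in auto)
    finally have 2: "(\<Sum>l\<in>{l \<in> I. 2 \<le> \<bar>k - l\<bar>}. v l) \<le> v k" using N by simp
    have "(\<Sum>l\<in>I. v l) = (\<Sum>l\<in>{l \<in> I. \<not> 2 \<le> \<bar>k - l\<bar>}. v l) + (\<Sum>l\<in>{l \<in> I. 2 \<le> \<bar>k - l\<bar>}. v l)"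
      by (subst split, rule sum.union_disjoint) (use fin in auto)
    with 1 2 w have "w \<le> 4 * v k" by linarith
    then have "w powr (q + 2) \<le> (4 * v k) powr (q + 2)" using w p by (intro powr_mono2) auto
    also have "\<dots> = 4 powr (q + 2) * v k powr (q + 2)" using v[OF k(1)] by (simp add: powr_mult)
    also have "\<dots> \<le> 4 powr 6 * ?A"
      using p k fin by (intro mult_mono powr_mono member_le_sum) auto
    also have "(4::real) powr 6 = 4 ^ 6" using powr_realpow[of 4 6] by simp
    finally have "w powr (q + 2) \<le> 4 ^ 6 * ?A" .
    moreover have "0 \<le> N ^ 10 * ?B" using B0 N by (intro mult_nonneg_nonneg) auto
    ultimately show ?thesis by linarith
  next
    case False
    then obtain l where l: "l \<in> I" "2 \<le> \<bar>k - l\<bar>" "v k / N < v l" by auto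
    have "v k \<le> N * v l" using l(3) N by (simp add: field_simps)
    have "w \<le> real (card I) * v k" using w sum_bounded_above[of I v "v k"] M by simp
    also have "\<dots> \<le> N * v k" using N v[OF k(1)] by (intro mult_right_mono) auto
    \<comment> \<open>\<open>w \<le> N * v k\<close> costs N to the power q + 2 and
      \<open>v k \<le> N * v l\<close> costs q more; the total 2 q + 2 is at most 10.\<close>
    finally have "w powr (q + 2) \<le> (N * v k) powr (q + 2)" using w p by (intro powr_mono2) auto
    also have "\<dots> = N powr (q + 2) * ((v k)\<^sup>2 * v k powr q)"
      using v[OF k(1)] N p by (cases "v k = 0") (auto simp: powr_mult powr_add powr_numeral)
    also have "\<dots> \<le> N powr (q + 2) * ((v k)\<^sup>2 * (N * v l) powr q)"
      using \<open>v k \<le> N * v l\<close> v[OF k(1)] p by (intro mult_left_mono powr_mono2) auto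
    also have "\<dots> = N powr (q + 2) * N powr q * ((v k)\<^sup>2 * v l powr q)"
      using N v[OF l(1)] by (simp add: powr_mult)
    also have "\<dots> \<le> N ^ 10 * ?B"
    proof (rule mult_mono)
      have "N powr (q + 2) * N powr q = N powr (q + 2 + q)" by (simp only: powr_add[symmetric])
      also have "\<dots> \<le> N powr 10" using N p by (intro powr_mono) auto
      also have "\<dots> = N ^ 10" using N powr_realpow[of N 10] by simp
      finally show "N powr (q + 2) * N powr q \<le> N ^ 10" .
      have "(v k)\<^sup>2 * v l powr q \<le> (\<Sum>l\<in>{l \<in> I. 2 \<le> \<bar>k - l\<bar>}. (v k)\<^sup>2 * v l powr q)"
        using l fin by (intro member_le_sum) auto
      also have "\<dots> \<le> ?B"
        using k fin by (intro member_le_sum[of k I "\<lambda>k. \<Sum>l\<in>{l \<in> I. 2 \<le> \<bar>k - l\<bar>}. (v k)\<^sup>2 * v l powr q"]) (auto intro: sum_nonneg)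
      finally show "(v k)\<^sup>2 * v l powr q \<le> ?B" .
    qed (use N in auto)
    finally show ?thesis using A0 by simp
  qed
qed (use assms in \<open>auto simp: sum_nonneg\<close>)

section \<open>Exchange of roles, iteration of the bilinear bound, recursion on scales\<close>

context decoupling
begin

lemma q_plus_2: "q + 2 = p" by (simp add: q_def)

lemma half_p: "p / 2 = 1 + q / 2" unfolding q_def by argo

text \<open>The Hoelder exponent that splits the bilinear integrand into the reversed bilinear one
  and the linear one; it is below 1 because p > 4.\<close>

definition \<alpha> :: real where "\<alpha> = 2 / q"

lemma alpha: "0 < \<alpha>" "\<alpha> < 1" using q by (auto simp: \<alpha>_def)

lemma lin_boundD:
  "lin_bound r Y \<Longrightarrow> adm S r \<Longrightarrow>
    (\<integral>\<^sup>+z. ennreal (norm (esum S c z) powr p) \<partial>\<mu>) \<le> ennreal (Y * energy S c powr (p/2))"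
  unfolding lin_bound_def by simp

lemma lin_bound_mono:
  assumes "lin_bound r Y" "r' \<le> r" "Y \<le> Y'" shows "lin_bound r' Y'"
  unfolding lin_bound_def
proof (intro allI impI)
  fix S c assume "adm S r'"
  then have "(\<integral>\<^sup>+z. ennreal (norm (esum S c z) powr p) \<partial>\<mu>) \<le> ennreal (Y * energy S c powr (p/2))"
    by (intro lin_boundD[OF assms(1)] adm_mono[OF _ assms(2)])
  also have "\<dots> \<le> ennreal (Y' * energy S c powr (p/2))"
    using assms(3) by (intro ennreal_leI mult_right_mono) auto
  finally show "(\<integral>\<^sup>+z. ennreal (norm (esum S c z) powr p) \<partial>\<mu>) \<le> \<dots>" .
qed

lemma bil_bound_mono:
  assumes "bil_bound d s t X" "s' \<le> s" "t' \<le> t" "X \<le> X'" shows "bil_bound d s' t' X'"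
  unfolding bil_bound_def
proof (intro allI impI)
  fix S T c e assume "adm S s'" "adm T t'" and *: "\<forall>a\<in>S. \<forall>b\<in>T. d \<le> \<bar>a - b\<bar> \<and> \<bar>a - b\<bar> \<le> 1"
  then have "(\<integral>\<^sup>+z. ennreal ((norm (esum S c z))\<^sup>2 * norm (esum T e z) powr q) \<partial>\<mu>)
      \<le> ennreal (X * energy S c * energy T e powr (q/2))"
    by (intro bil_boundD[OF assms(1)] adm_mono[OF _ assms(2)] adm_mono[OF _ assms(3)]) auto
  also have "\<dots> \<le> ennreal (X' * energy S c * energy T e powr (q/2))"
    using assms(4) by (intro ennreal_leI mult_right_mono) (auto simp: energy_nonneg)
  finally show "(\<integral>\<^sup>+z. ennreal ((norm (esum S c z))\<^sup>2 * norm (esum T e z) powr q) \<partial>\<mu>) \<le> \<dots>" .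
qed

text \<open>Young's inequality for u^2 v^q = (v^2 u^q)^\<alpha> (v^p)^(1 - \<alpha>), normalised by
  A and B. When A and B bound the two integrals, integrating gives Hoelder's inequality.\<close>

lemma interpolation_pointwise:
  assumes "0 \<le> u" "0 \<le> v" "0 < A" "0 < B"
  shows "u\<^sup>2 * v powr q \<le> A powr \<alpha> * B powr (1 - \<alpha>) * (\<alpha> / A * (v\<^sup>2 * u powr q) + (1 - \<alpha>) / B * v powr p)"
proof (cases "u = 0 \<or> v = 0")
  case False
  then have uv: "0 < u" "0 < v" using assms by auto
  \<comment> \<open>The exponents match: q \<alpha> = 2 for u and 2 \<alpha> + p (1 - \<alpha>) = q
    for v.\<close>
  have e2: "q * \<alpha> = 2" using q by (simp add: \<alpha>_def)
  then have e1: "2 * \<alpha> + p * (1 - \<alpha>) = q" by (simp add: q_def algebra_simps)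
  have "(v\<^sup>2 * u powr q / A) powr \<alpha> * (v powr p / B) powr (1 - \<alpha>) \<le> \<alpha> * (v\<^sup>2 * u powr q / A) + (1 - \<alpha>) * (v powr p / B)"
    using alpha uv assms by (intro Youngs_inequality_0) auto
  moreover have "(v\<^sup>2 * u powr q / A) powr \<alpha> * (v powr p / B) powr (1 - \<alpha>) = u\<^sup>2 * v powr q / (A powr \<alpha> * B powr (1 - \<alpha>))"
  proof -
    have "v\<^sup>2 = v powr 2" using uv by simp
    then have "(v\<^sup>2 * u powr q / A) powr \<alpha> = v powr (2 * \<alpha>) * u powr (q * \<alpha>) / A powr \<alpha>"
      using uv assms by (simp add: powr_divide powr_mult powr_powr del: powr_numeral)
    moreover have "(v powr p / B) powr (1 - \<alpha>) = v powr (p * (1 - \<alpha>)) / B powr (1 - \<alpha>)"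
      using uv assms by (simp add: powr_divide powr_powr)
    moreover have "v powr (2 * \<alpha>) * v powr (p * (1 - \<alpha>)) = v powr q"
      by (simp only: powr_add[symmetric] e1)
    moreover have "u powr (q * \<alpha>) = u\<^sup>2" using uv by (simp add: e2 powr_numeral)
    ultimately show ?thesis by (simp add: mult_ac)
  qed
  ultimately have "u\<^sup>2 * v powr q / (A powr \<alpha> * B powr (1 - \<alpha>)) \<le> \<alpha> / A * (v\<^sup>2 * u powr q) + (1 - \<alpha>) / B * v powr p"
    by simp
  moreover have "0 < A powr \<alpha> * B powr (1 - \<alpha>)" using assms by simp
  ultimately show ?thesis by (simp only: pos_divide_le_eq mult.commute)
qed (use assms alpha q in auto)

text \<open>X controls the reversed pair, where T carries exponent 2, and Y the remaining powers of
  the sum over T; hence the linear bound enters at the scale t of T.\<close>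

lemma bil_bound_swap:
  assumes bil: "bil_bound d t s X" and lin: "lin_bound t Y" and X: "0 < X" and Y: "0 < Y"
  shows "bil_bound d s t (X powr \<alpha> * Y powr (1 - \<alpha>))"
  unfolding bil_bound_def
proof (intro allI impI)
  fix S T c e
  assume S: "adm S s" and T: "adm T t" and ST: "\<forall>a\<in>S. \<forall>b\<in>T. d \<le> \<bar>a - b\<bar> \<and> \<bar>a - b\<bar> \<le> 1"
  show "(\<integral>\<^sup>+z. ennreal ((norm (esum S c z))\<^sup>2 * norm (esum T e z) powr q) \<partial>\<mu>)
      \<le> ennreal (X powr \<alpha> * Y powr (1 - \<alpha>) * energy S c * energy T e powr (q/2))"
  proof (cases "energy S c = 0 \<or> energy T e = 0")
    \<comment> \<open>Zero energy would make A or B vanish, and the normalisation divides by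
      both.\<close>
    case True
    have "norm (esum S c z) = 0 \<or> norm (esum T e z) = 0" for z
      using energy_eq_0_imp_esum[OF admD(1)[OF S], of c z] energy_eq_0_imp_esum[OF admD(1)[OF T], of e z] True
      by (simp only: norm_eq_zero) blast
    then have "(norm (esum S c z))\<^sup>2 * norm (esum T e z) powr q = 0" for z using q by (simp only: mult_eq_0_iff power_eq_0_iff powr_eq_0_iff) simp
    then show ?thesis by (simp only:) simp
  next
    case False
    then have E: "0 < energy S c" "0 < energy T e"
      using energy_nonneg[of S c] energy_nonneg[of T e] by auto
    define A where "A = X * energy T e * energy S c powr (q/2)"
    define B where "B = Y * energy T e powr (p/2)"
    define Z where "Z = A powr \<alpha> * B powr (1 - \<alpha>)"
    have AB: "0 < A" "0 < B" using X Y E by (auto simp: A_def B_def)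
    have bA: "(\<integral>\<^sup>+z. ennreal ((norm (esum T e z))\<^sup>2 * norm (esum S c z) powr q) \<partial>\<mu>) \<le> ennreal A"
      unfolding A_def using ST by (intro bil_boundD[OF bil T S]) (metis abs_minus_commute)
    have bB: "(\<integral>\<^sup>+z. ennreal (norm (esum T e z) powr p) \<partial>\<mu>) \<le> ennreal B"
      unfolding B_def by (rule lin_boundD[OF lin T])
    have "(\<integral>\<^sup>+z. ennreal ((norm (esum S c z))\<^sup>2 * norm (esum T e z) powr q) \<partial>\<mu>)
       \<le> (\<integral>\<^sup>+z. ennreal (Z * (\<alpha> / A * ((norm (esum T e z))\<^sup>2 * norm (esum S c z) powr q) + (1 - \<alpha>) / B * norm (esum T e z) powr p)) \<partial>\<mu>)"
      unfolding Z_def by (intro nn_integral_mono ennreal_leI interpolation_pointwise AB) auto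
    also have "\<dots> \<le> ennreal (Z * (\<alpha> / A * A + (1 - \<alpha>) / B * B))"
    proof (rule nn_integral_cmult_le, measurable)
      show "(\<integral>\<^sup>+z. ennreal (\<alpha> / A * ((norm (esum T e z))\<^sup>2 * norm (esum S c z) powr q) + (1 - \<alpha>) / B * norm (esum T e z) powr p) \<partial>\<mu>)
        \<le> ennreal (\<alpha> / A * A + (1 - \<alpha>) / B * B)"
        using alpha AB by (intro nn_integral_add_le nn_integral_cmult_le bA bB) (auto, measurable)
    qed (use alpha AB in \<open>auto simp: Z_def\<close>)
    also have "Z * (\<alpha> / A * A + (1 - \<alpha>) / B * B) = Z" using AB by simp
    also have "Z = X powr \<alpha> * Y powr (1 - \<alpha>) * energy S c * energy T e powr (q/2)"
    proof -
      have e2: "q / 2 * \<alpha> = 1" using q by (simp add: \<alpha>_def)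
      have "a + (1 + x) * (1 - a) = x" if "x * a = 1" for a x :: real using that by algebra
      from this[OF e2] have e1: "\<alpha> + p / 2 * (1 - \<alpha>) = q / 2" by (simp only: half_p)
      have "A powr \<alpha> = X powr \<alpha> * energy T e powr \<alpha> * energy S c"
        unfolding A_def powr_mult powr_powr e2 using E by simp
      moreover have "B powr (1 - \<alpha>) = Y powr (1 - \<alpha>) * energy T e powr (p / 2 * (1 - \<alpha>))"
        using Y E by (simp add: B_def powr_mult powr_powr)
      moreover have "energy T e powr \<alpha> * energy T e powr (p / 2 * (1 - \<alpha>)) = energy T e powr (q / 2)"
        by (simp only: powr_add[symmetric] e1)
      ultimately show ?thesis by (simp add: Z_def mult_ac)
    qed
    finally show ?thesis .
  qed
qed

lemma norm_esum_singleton: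
  assumes "adm S s" "s < \<delta>" shows "norm (esum S c z) = sqrt (energy S c)"
proof -
  have "a = b" if "a \<in> S" "b \<in> S" for a b
    using admD(2,3)[OF assms(1) that] assms(2) by fastforce
  then consider "S = {}" | a where "S = {a}" by blast
  then show ?thesis by cases (auto simp: esum_def energy_def norm_mult)
qed

text \<open>A separated set of diameter \<delta>/2 has at most one point, so both moduli are
  constant and the mass bound suffices. This starts the iteration.\<close>

lemma bil_bound_single: "bil_bound d (\<delta>/2) (\<delta>/2) 1"
  unfolding bil_bound_def
proof (intro allI impI)
  fix S T c e assume "adm S (\<delta>/2)" "adm T (\<delta>/2)"
  have "(norm (esum S c z))\<^sup>2 * norm (esum T e z) powr q = 1 * energy S c * energy T e powr (q/2)" for z
  proof -
    have "sqrt (energy T e) powr q = energy T e powr (q/2)"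
      by (simp only: powr_half_sqrt[OF energy_nonneg, symmetric] powr_powr) simp
    then show ?thesis
      using \<delta> \<open>adm S (\<delta>/2)\<close> \<open>adm T (\<delta>/2)\<close> by (simp add: norm_esum_singleton[where s="\<delta>/2"] energy_nonneg)
  qed
  then show "(\<integral>\<^sup>+z. ennreal ((norm (esum S c z))\<^sup>2 * norm (esum T e z) powr q) \<partial>\<mu>)
      \<le> ennreal (1 * energy S c * energy T e powr (q/2))"
    using mult_left_mono[OF mass, of "ennreal (1 * energy S c * energy T e powr (q/2))"] by simp
qed

lemma card_adm_le:
  assumes "adm S r" "0 \<le> r" shows "real (card S) \<le> r / \<delta> + 2"
proof -
  \<comment> \<open>Points of one half-open cell are strictly closer than its length \<delta>, so a
    cell holds at most one point.\<close>
  have "inj_on (\<lambda>\<theta>. \<lfloor>\<theta> / \<delta>\<rfloor>) S"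
  proof (rule inj_onI, rule ccontr)
    fix a b assume ab: "a \<in> S" "b \<in> S" "\<lfloor>a / \<delta>\<rfloor> = \<lfloor>b / \<delta>\<rfloor>" "a \<noteq> b"
    then have "\<bar>a - b\<bar> < \<delta>" by (intro piece_diam[OF \<delta>, of _ S "\<lfloor>a / \<delta>\<rfloor>"]) (auto simp: piece_def)
    with admD(2)[OF assms(1) ab(1,2,4)] show False by simp
  qed
  then have "card S = card (cells S \<delta>)" by (simp add: cells_def card_image)
  then show ?thesis using card_cells_le[OF admD(1)[OF assms(1)] \<delta> assms(2) admD(3)[OF assms(1)]] by simp
qed

text \<open>Cauchy-Schwarz and counting, with p/2 \<le> 3. It serves as the base of the recursion on
  scales.\<close>

lemma lin_bound_count:
  assumes "0 \<le> r" shows "lin_bound r ((r / \<delta> + 2) ^ 3)"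
  unfolding lin_bound_def
proof (intro allI impI)
  fix S c assume S: "adm S r"
  define n where "n = r / \<delta> + 2"
  have n: "1 \<le> n" using assms \<delta> by (simp add: n_def)
  have "norm (esum S c z) powr p \<le> n ^ 3 * energy S c powr (p/2)" for z
  proof -
    have "(norm (esum S c z))\<^sup>2 \<le> real (card S) * energy S c" by (rule norm_esum_square_le[OF admD(1)[OF S]])
    also have "\<dots> \<le> n * energy S c"
      using card_adm_le[OF S assms] by (intro mult_right_mono) (auto simp: n_def energy_nonneg)
    finally have "((norm (esum S c z))\<^sup>2) powr (p/2) \<le> (n * energy S c) powr (p/2)"
      using p by (intro powr_mono2) auto
    also have "\<dots> = n powr (p/2) * energy S c powr (p/2)" using n by (simp add: powr_mult energy_nonneg)
    also have "\<dots> \<le> n powr 3 * energy S c powr (p/2)" using n p by (intro mult_right_mono powr_mono) auto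
    also have "n powr 3 = n ^ 3" using n powr_realpow[of n 3] by simp
    also have "((norm (esum S c z))\<^sup>2) powr (p/2) = norm (esum S c z) powr p"
    proof (cases "esum S c z = 0")
      case False
      then have "(norm (esum S c z))\<^sup>2 = norm (esum S c z) powr 2" by simp
      then show ?thesis by (simp only: powr_powr) simp
    qed simp
    finally show ?thesis .
  qed
  then have "(\<integral>\<^sup>+z. ennreal (norm (esum S c z) powr p) \<partial>\<mu>) \<le> (\<integral>\<^sup>+z. ennreal (n ^ 3 * energy S c powr (p/2)) \<partial>\<mu>)"
    by (intro nn_integral_mono ennreal_leI)
  also have "\<dots> \<le> ennreal (n ^ 3 * energy S c powr (p/2))"
    using mult_left_mono[OF mass, of "ennreal (n ^ 3 * energy S c powr (p/2))"] by simp
  finally show "(\<integral>\<^sup>+z. ennreal (norm (esum S c z) powr p) \<partial>\<mu>) \<le> ennreal ((r / \<delta> + 2) ^ 3 * energy S c powr (p/2))"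
    by (simp add: n_def)
qed

text \<open>The scales run from single points up to d / K, with one \<open>bil_bound_swap\<close>
  and one \<open>bil_bound_decouple\<close> per step. The exponent of Y passes from e to \<alpha> e
  + 1 - \<alpha>, so 1 - e shrinks by \<alpha> each time.\<close>

lemma bil_bound_iterate:
  assumes K: "4 \<le> K" and d: "2 * \<delta> \<le> d" "d \<le> 1" and m: "(4 / K) ^ (2 ^ m) \<le> \<delta>"
    and lin: "lin_bound d Y" and Y: "1 \<le> Y"
  shows "bil_bound d d (d / K) (decouple_const ^ (m + 1) * Y powr (1 - \<alpha> ^ m))"
proof -
  \<comment> \<open>\<open>4 * (T k)\<^sup>2 / d \<le> T (k + 1)\<close>; the cut-off \<open>\<delta>/2\<close> forces single points while keeping \<open>T k \<ge> \<delta>/2\<close>.\<close>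
  define T where "T k = max (\<delta>/2) (d * (4 / K) ^ (2 ^ k) / 4)" for k :: nat
  have d0: "0 < d" using d \<delta> by simp
  have T_le: "T k \<le> d" for k
  proof -
    have "d * (4 / K) ^ (2 ^ k) \<le> d * 1" using K d0 by (intro mult_left_mono power_le_one) auto
    then show ?thesis using d \<delta> d0 by (simp add: T_def)
  qed
  have T_step: "4 * (T k)\<^sup>2 / d \<le> T (Suc k)" for k
  proof -
    have "4 * (\<delta>/2)\<^sup>2 / d \<le> \<delta> / 2"
    proof -
      have "2 * \<delta> * \<delta> \<le> d * \<delta>" using d \<delta> by (intro mult_right_mono) auto
      then show ?thesis using d0 by (simp add: field_simps power2_eq_square)
    qed
    moreover have "4 * (d * (4 / K) ^ (2 ^ k) / 4)\<^sup>2 / d = d * (4 / K) ^ (2 ^ Suc k) / 4"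
      using d0 by (simp add: power2_eq_square power_add mult_2 field_simps)
    ultimately show ?thesis by (auto simp: T_def max_def)
  qed
  have "bil_bound d d (T (m - j)) (decouple_const ^ (j + 1) * Y powr (1 - \<alpha> ^ j))" if "j \<le> m" for j
    using that
  proof (induction j)
    case 0
    \<comment> \<open>Both sets start as single points; one decoupling widens the first to diameter
      d, which uses 2 \<delta> \<le> d.\<close>
    have "bil_bound d d (\<delta>/2) (decouple_const * 1)"
    proof (rule bil_bound_decouple[OF bil_bound_single])
      have "2 * \<delta> * \<delta> \<le> d * \<delta>" using d \<delta> by (intro mult_right_mono) auto
      then show "4 * (\<delta> / 2)\<^sup>2 / d \<le> \<delta> / 2" using d0 by (simp add: field_simps power2_eq_square)
    qed (use d0 in auto)
    moreover have "T m = \<delta>/2"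
    proof -
      have "d * (4 / K) ^ (2 ^ m) \<le> 1 * \<delta>" using d d0 m K by (intro mult_mono) auto
      then show ?thesis using \<delta> by (simp add: T_def)
    qed
    ultimately show ?case using Y by (simp only: diff_zero) simp
  next
    case (Suc j)
    define k where "k = m - Suc j"
    have k: "m - j = Suc k" using Suc.prems by (simp add: k_def)
    define X where "X = decouple_const ^ (j + 1) * Y powr (1 - \<alpha> ^ j)"
    have X: "0 < X" using decouple_const_ge_1 Y by (simp add: X_def)
    have "bil_bound d d (T (Suc k)) X" using Suc by (simp add: X_def k)
    \<comment> \<open>S is first narrowed to T k, so that after the exchange the set with exponent q
      has diameter T k and the next decoupling can use its local constancy.\<close>
    then have "bil_bound d (T k) (T (Suc k)) X" by (rule bil_bound_mono) (auto simp: T_le)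
    then have "bil_bound d (T (Suc k)) (T k) (X powr \<alpha> * Y powr (1 - \<alpha>))"
      using X Y by (intro bil_bound_swap lin_bound_mono[OF lin T_le]) auto
    then have "bil_bound d d (T k) (decouple_const * (X powr \<alpha> * Y powr (1 - \<alpha>)))"
      by (rule bil_bound_decouple) (use d0 T_step in \<open>auto simp: T_def\<close>)
    moreover have "decouple_const * (X powr \<alpha> * Y powr (1 - \<alpha>)) \<le> decouple_const ^ (Suc j + 1) * Y powr (1 - \<alpha> ^ Suc j)"
    proof -
      have C: "1 \<le> decouple_const ^ (j + 1)" using decouple_const_ge_1 by (rule one_le_power)
      have "X powr \<alpha> = (decouple_const ^ (j + 1)) powr \<alpha> * Y powr ((1 - \<alpha> ^ j) * \<alpha>)"
        using C by (simp add: X_def powr_mult powr_powr)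
      \<comment> \<open>The gain from raising the accumulated constant to \<alpha> is given away, so
        each step adds one factor \<open>decouple_const\<close>.\<close>
      also have "\<dots> \<le> (decouple_const ^ (j + 1)) powr 1 * Y powr ((1 - \<alpha> ^ j) * \<alpha>)"
        using C alpha by (intro mult_right_mono powr_mono) auto
      finally have "X powr \<alpha> * Y powr (1 - \<alpha>) \<le> decouple_const ^ (j + 1) * Y powr ((1 - \<alpha> ^ j) * \<alpha>) * Y powr (1 - \<alpha>)"
        using C by (intro mult_right_mono) auto
      also have "\<dots> = decouple_const ^ (j + 1) * Y powr (1 - \<alpha> ^ Suc j)"
        by (simp add: powr_add[symmetric] algebra_simps)
      finally show ?thesis using decouple_const_ge_1 by simp
    qed
    ultimately show ?case unfolding k_def using bil_bound_mono[OF _ order_refl order_refl] by blast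
  qed
  from this[of m] have "bil_bound d d (T 0) (decouple_const ^ (m + 1) * Y powr (1 - \<alpha> ^ m))" by simp
  \<comment> \<open>T 0 is at least d / K because its exponent is 2 ^ 0 = 1.\<close>
  then show ?thesis by (rule bil_bound_mono) (auto simp: T_def)
qed

lemma lin_bound_step:
  assumes K: "4 \<le> K" and r: "0 < r" "r \<le> 1" and lin: "lin_bound (r / K) Y" and Y: "0 \<le> Y"
    and bil: "bil_bound (r / K) (r / K) (r / K / K) X" and X: "0 \<le> X"
  shows "lin_bound r (4 ^ 6 * Y + (2 * K) ^ 17 * X)"
  unfolding lin_bound_def
proof (intro allI impI)
  fix S c assume S: "adm S r"
  define d where "d = r / K"
  define N where "N = 2 * K"
  have d: "0 < d" "0 < d / K" using r K by (auto simp: d_def)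
  have N: "1 \<le> N" using K by (simp add: N_def)
  have fin: "finite S" by (rule admD(1)[OF S])
  define E where "E = energy S c"
  have E0: "0 \<le> E" by (simp add: E_def energy_nonneg)
  define f where "f k z = norm (esum (piece S d k) c z)" for k z
  have [measurable]: "f k \<in> borel_measurable borel" for k unfolding f_def by measurable
  have f0 [simp]: "0 \<le> f k z" for k z by (simp add: f_def)
  have cardN: "real (card (cells S d)) \<le> N"
    using card_cells_le[OF fin d(1) less_imp_le[OF r(1)] admD(3)[OF S]] K r by (simp add: d_def N_def)
  have cardN': "real (card (cells (piece S d l) (d / K))) \<le> N" for l
  proof -
    have "real (card (cells (piece S d l) (d / K))) \<le> d / (d / K) + 2"
      by (rule card_cells_le[OF finite_piece[OF fin] d(2) less_imp_le[OF d(1)] less_imp_le[OF piece_diam[OF d(1)]]])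
    then show ?thesis using K d by (simp add: N_def)
  qed
  have E_split: "E * E powr (q/2) = E powr (p/2)"
    using E0 by (cases "E = 0") (auto simp: half_p powr_add energy_nonneg)
  have narrow: "(\<integral>\<^sup>+z. ennreal (\<Sum>k\<in>cells S d. f k z powr p) \<partial>\<mu>) \<le> ennreal (Y * E powr (p/2))"
  proof -
    have "(\<integral>\<^sup>+z. ennreal (\<Sum>k\<in>cells S d. f k z powr p) \<partial>\<mu>) \<le> ennreal (\<Sum>k\<in>cells S d. Y * energy (piece S d k) c powr (p/2))"
      unfolding f_def using Y
      by (intro nn_integral_sum_le finite_cells[OF fin] lin_boundD[OF lin[folded d_def]] adm_piece[OF S d(1)]) auto
    also have "(\<Sum>k\<in>cells S d. Y * energy (piece S d k) c powr (p/2)) \<le> Y * E powr (p/2)"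
    proof -
      \<comment> \<open>Since p/2 = 1 + q/2, one power of the energy is kept for summation and the
        rest is bounded by the total. The narrow term thus loses nothing in the number of
        pieces.\<close>
      have "energy (piece S d k) c powr (p/2) \<le> energy (piece S d k) c * E powr (q/2)" for k
      proof -
        have le: "energy (piece S d k) c \<le> E" unfolding E_def by (rule energy_mono[OF fin piece_subset])
        have "energy (piece S d k) c powr (p/2) = energy (piece S d k) c * energy (piece S d k) c powr (q/2)"
          using energy_nonneg[of "piece S d k" c]
          by (cases "energy (piece S d k) c = 0") (auto simp: half_p powr_add energy_nonneg)
        also have "\<dots> \<le> energy (piece S d k) c * E powr (q/2)"
          using le q by (intro mult_left_mono powr_mono2) (auto simp: energy_nonneg)
        finally show ?thesis .
      qed
      then have "(\<Sum>k\<in>cells S d. energy (piece S d k) c powr (p/2)) \<le> (\<Sum>k\<in>cells S d. energy (piece S d k) c * E powr (q/2))"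
        by (intro sum_mono)
      also have "\<dots> = E powr (p/2)"
        by (simp only: sum_distrib_right[symmetric] energy_pieces[OF fin, symmetric] E_def[symmetric] E_split)
      finally show ?thesis using Y by (simp add: sum_distrib_left[symmetric] mult_left_mono)
    qed
    finally show ?thesis by (simp add: ennreal_leI)
  qed
  have pair: "(\<integral>\<^sup>+z. ennreal ((f k z)\<^sup>2 * f l z powr q) \<partial>\<mu>) \<le> ennreal (N ^ 5 * (X * E powr (p/2)))"
    if kl: "2 \<le> \<bar>k - l\<bar>" for k l
  proof -
    define g where "g j z = norm (esum (piece (piece S d l) (d/K) j) c z)" for j z
    have [measurable]: "g j \<in> borel_measurable borel" for j unfolding g_def by measurable
    \<comment> \<open>The second cut uses the crude power bound: q \<le> 4 gives
      \<open>N ^ 4\<close>, and the number of terms contributes one more N.\<close>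
    have "(f k z)\<^sup>2 * f l z powr q \<le> N ^ 4 * (\<Sum>j\<in>cells (piece S d l) (d/K). (f k z)\<^sup>2 * g j z powr q)" for z
    proof -
      have "f l z powr q \<le> N powr q * (\<Sum>j\<in>cells (piece S d l) (d/K). g j z powr q)"
        using q unfolding f_def g_def esum_pieces[OF finite_piece[OF fin, of d l], of c z "d/K"]
        by (intro powr_le_card_powr_sum cardN' finite_cells[OF finite_piece[OF fin]] norm_sum) auto
      also have "\<dots> \<le> N ^ 4 * (\<Sum>j\<in>cells (piece S d l) (d/K). g j z powr q)"
      proof (rule mult_right_mono)
        have "N powr q \<le> N powr 4" using N q by (intro powr_mono) auto
        then show "N powr q \<le> N ^ 4" using N powr_realpow[of N 4] by simp
      qed (simp add: sum_nonneg)
      finally have "(f k z)\<^sup>2 * f l z powr q \<le> (f k z)\<^sup>2 * (N ^ 4 * (\<Sum>j\<in>cells (piece S d l) (d/K). g j z powr q))"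
        by (intro mult_left_mono) auto
      then show ?thesis by (simp add: sum_distrib_left mult_ac)
    qed
    then have "(\<integral>\<^sup>+z. ennreal ((f k z)\<^sup>2 * f l z powr q) \<partial>\<mu>)
        \<le> (\<integral>\<^sup>+z. ennreal (N ^ 4 * (\<Sum>j\<in>cells (piece S d l) (d/K). (f k z)\<^sup>2 * g j z powr q)) \<partial>\<mu>)"
      by (intro nn_integral_mono ennreal_leI)
    also have "\<dots> \<le> ennreal (N ^ 4 * (\<Sum>j\<in>cells (piece S d l) (d/K). X * E powr (p/2)))"
    proof (intro nn_integral_cmult_le nn_integral_sum_le finite_cells[OF finite_piece[OF fin]])
      fix j
      have "(\<integral>\<^sup>+z. ennreal ((f k z)\<^sup>2 * g j z powr q) \<partial>\<mu>)
          \<le> ennreal (X * energy (piece S d k) c * energy (piece (piece S d l) (d/K) j) c powr (q/2))"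
        unfolding f_def g_def
      proof (rule bil_boundD[OF bil[folded d_def]])
        show "adm (piece S d k) d" by (rule adm_piece[OF S d(1)])
        show "adm (piece (piece S d l) (d / K) j) (d / K)" by (rule adm_piece[OF adm_piece[OF S d(1)] d(2)])
        fix a b assume "a \<in> piece S d k" "b \<in> piece (piece S d l) (d / K) j"
        then have ab: "a \<in> piece S d k" "b \<in> piece S d l" "a \<in> S" "b \<in> S" by (auto simp: piece_def)
        show "d \<le> \<bar>a - b\<bar> \<and> \<bar>a - b\<bar> \<le> 1"
          using piece_separated[OF d(1) ab(1,2) kl] admD(3)[OF S ab(3,4)] r by linarith
      qed
      also have "\<dots> \<le> ennreal (X * E * E powr (q/2))"
        using X q energy_mono[OF fin piece_subset[of S d k], of c]
          energy_mono[OF fin, of "piece (piece S d l) (d / K) j" c]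
        by (intro ennreal_leI mult_mono powr_mono2)
           (auto simp: E_def energy_nonneg piece_def)
      finally show "(\<integral>\<^sup>+z. ennreal ((f k z)\<^sup>2 * g j z powr q) \<partial>\<mu>) \<le> ennreal (X * E powr (p/2))"
        by (simp add: mult.assoc E_split)
    qed (use X N in \<open>auto simp: sum_nonneg\<close>)
    also have "\<dots> \<le> ennreal (N ^ 5 * (X * E powr (p/2)))"
    proof (rule ennreal_leI)
      have "real (card (cells (piece S d l) (d/K))) * (X * E powr (p/2)) \<le> N * (X * E powr (p/2))"
        using cardN'[of l] X by (intro mult_right_mono) auto
      then have "N ^ 4 * (real (card (cells (piece S d l) (d/K))) * (X * E powr (p/2))) \<le> N ^ 4 * (N * (X * E powr (p/2)))"
        using N by (intro mult_left_mono) auto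
      also have "\<dots> = N ^ 5 * (X * E powr (p/2))" by (simp add: eval_nat_numeral mult_ac)
      finally show "N ^ 4 * (\<Sum>j\<in>cells (piece S d l) (d/K). X * E powr (p/2)) \<le> N ^ 5 * (X * E powr (p/2))" by simp
    qed
    finally show ?thesis .
  qed
  have broad: "(\<integral>\<^sup>+z. ennreal (\<Sum>k\<in>cells S d. \<Sum>l\<in>{l \<in> cells S d. 2 \<le> \<bar>k - l\<bar>}. (f k z)\<^sup>2 * f l z powr q) \<partial>\<mu>)
      \<le> ennreal (N ^ 7 * (X * E powr (p/2)))"
  proof -
    have pos: "0 \<le> N ^ 5 * (X * E powr (p/2))" using N X by simp
    have "(\<integral>\<^sup>+z. ennreal (\<Sum>k\<in>cells S d. \<Sum>l\<in>{l \<in> cells S d. 2 \<le> \<bar>k - l\<bar>}. (f k z)\<^sup>2 * f l z powr q) \<partial>\<mu>)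
      \<le> ennreal (\<Sum>k\<in>cells S d. \<Sum>l\<in>{l \<in> cells S d. 2 \<le> \<bar>k - l\<bar>}. N ^ 5 * (X * E powr (p/2)))"
      using pos by (intro nn_integral_sum_le pair) (auto simp: finite_cells[OF fin] sum_nonneg)
    also have "\<dots> \<le> ennreal (N * (N * (N ^ 5 * (X * E powr (p/2)))))"
    proof (intro ennreal_leI)
      have "(\<Sum>l\<in>{l \<in> cells S d. 2 \<le> \<bar>k - l\<bar>}. N ^ 5 * (X * E powr (p/2))) \<le> N * (N ^ 5 * (X * E powr (p/2)))" for k
      proof -
        have "card {l \<in> cells S d. 2 \<le> \<bar>k - l\<bar>} \<le> card (cells S d)" by (intro card_mono finite_cells[OF fin]) auto
        then have "real (card {l \<in> cells S d. 2 \<le> \<bar>k - l\<bar>}) \<le> N" using cardN by linarith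
        from mult_right_mono[OF this pos] show ?thesis by simp
      qed
      then have "(\<Sum>k\<in>cells S d. \<Sum>l\<in>{l \<in> cells S d. 2 \<le> \<bar>k - l\<bar>}. N ^ 5 * (X * E powr (p/2)))
          \<le> real (card (cells S d)) * (N * (N ^ 5 * (X * E powr (p/2))))"
        by (intro sum_bounded_above)
      also have "\<dots> \<le> N * (N * (N ^ 5 * (X * E powr (p/2))))"
        using cardN N pos by (intro mult_right_mono) auto
      finally show "(\<Sum>k\<in>cells S d. \<Sum>l\<in>{l \<in> cells S d. 2 \<le> \<bar>k - l\<bar>}. N ^ 5 * (X * E powr (p/2))) \<le> \<dots>" .
    qed
    also have "N * (N * (N ^ 5 * (X * E powr (p/2)))) = N ^ 7 * (X * E powr (p/2))" by (simp add: eval_nat_numeral mult_ac)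
    finally show ?thesis .
  qed
  have "norm (esum S c z) powr (q + 2) \<le> 4 ^ 6 * (\<Sum>k\<in>cells S d. f k z powr (q + 2))
     + N ^ 10 * (\<Sum>k\<in>cells S d. \<Sum>l\<in>{l \<in> cells S d. 2 \<le> \<bar>k - l\<bar>}. (f k z)\<^sup>2 * f l z powr q)" for z
    using q
    by (intro broad_narrow finite_cells[OF fin] cardN N) (auto simp: f_def esum_pieces[OF fin, of c z d] intro: norm_sum)
  note this[unfolded q_plus_2]
  then have "(\<integral>\<^sup>+z. ennreal (norm (esum S c z) powr p) \<partial>\<mu>) \<le> (\<integral>\<^sup>+z. ennreal (4 ^ 6 * (\<Sum>k\<in>cells S d. f k z powr p)
     + N ^ 10 * (\<Sum>k\<in>cells S d. \<Sum>l\<in>{l \<in> cells S d. 2 \<le> \<bar>k - l\<bar>}. (f k z)\<^sup>2 * f l z powr q)) \<partial>\<mu>)"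
    by (intro nn_integral_mono ennreal_leI)
  also have "\<dots> \<le> ennreal (4 ^ 6 * (Y * E powr (p/2)) + N ^ 10 * (N ^ 7 * (X * E powr (p/2))))"
    using N X Y
    by (intro nn_integral_add_le nn_integral_cmult_le narrow broad)
       (auto intro!: sum_nonneg mult_nonneg_nonneg[OF zero_le_power])
  also have "4 ^ 6 * (Y * E powr (p/2)) + N ^ 10 * (N ^ 7 * (X * E powr (p/2))) = (4 ^ 6 * Y + (2 * K) ^ 17 * X) * energy S c powr (p/2)"
    by (simp add: N_def E_def algebra_simps flip: power_add)
  finally show "(\<integral>\<^sup>+z. ennreal (norm (esum S c z) powr p) \<partial>\<mu>) \<le> ennreal ((4 ^ 6 * Y + (2 * K) ^ 17 * X) * energy S c powr (p/2))" .
qed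

text \<open>By \<open>h2\<close> the narrow term takes at most half of the new bound Y. By
  \<open>h3\<close> the broad term takes at most the other half: it grows like Y to the power 1 -
  \<alpha> ^ m, and \<open>\<Gamma> \<le> Y\<close> supplies the missing power. Small r is covered
  by counting and \<open>h1\<close>.\<close>

lemma lin_bound_main:
  assumes K: "4 \<le> K" and m: "(4 / K) ^ (2 ^ m) \<le> \<delta>" and \<eta>: "0 \<le> \<eta>"
    and h1: "8 * K ^ 6 \<le> \<Gamma>" and h2: "2 * 4 ^ 6 \<le> K powr \<eta>"
    and h3: "2 * ((2 * K) ^ 17 * decouple_const ^ (m + 1)) \<le> \<Gamma> powr (\<alpha> ^ m)"
    and r: "\<delta> \<le> r" "r \<le> 1"
  shows "lin_bound r (\<Gamma> * (r / \<delta>) powr \<eta>)"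
proof -
  have K1: "1 \<le> K ^ 6" using K by (intro one_le_power) auto
  have \<Gamma>: "1 \<le> \<Gamma>" using h1 K1 by linarith
  have base: "lin_bound r (\<Gamma> * (r / \<delta>) powr \<eta>)" if r: "\<delta> \<le> r" "r \<le> \<delta> * K\<^sup>2" for r
  proof (rule lin_bound_mono[OF lin_bound_count])
    have "r / \<delta> + 2 \<le> K\<^sup>2 + K\<^sup>2"
    proof (rule add_mono)
      show "r / \<delta> \<le> K\<^sup>2" using r \<delta> by (simp add: field_simps)
      show "2 \<le> K\<^sup>2" using power_mono[OF K, of 2] by simp
    qed
    then have "(r / \<delta> + 2) ^ 3 \<le> (2 * K\<^sup>2) ^ 3" using r \<delta> by (intro power_mono) auto
    also have "\<dots> = 8 * K ^ 6" by (simp add: power_mult_distrib flip: power_mult)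
    also have "\<dots> \<le> \<Gamma> * 1" using h1 by simp
    also have "\<dots> \<le> \<Gamma> * (r / \<delta>) powr \<eta>"
      using \<Gamma> \<eta> r \<delta> by (intro mult_left_mono ge_one_powr_ge_zero) auto
    finally show "(r / \<delta> + 2) ^ 3 \<le> \<Gamma> * (r / \<delta>) powr \<eta>" .
  qed (use r \<delta> in auto)
  \<comment> \<open>The offset 2 is the base range, so the step has r > \<delta> K^2; this leaves r
    / K above K \<delta>, as \<open>bil_bound_iterate\<close> requires with room.\<close>
  have "\<forall>r. \<delta> \<le> r \<longrightarrow> r \<le> 1 \<longrightarrow> r \<le> \<delta> * K ^ (n + 2) \<longrightarrow> lin_bound r (\<Gamma> * (r / \<delta>) powr \<eta>)" for n
  proof (induction n)
    case 0
    then show ?case using base by (simp add: power2_eq_square)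
  next
    case (Suc n)
    show ?case
    proof (intro allI impI)
      fix r assume r: "\<delta> \<le> r" "r \<le> 1" "r \<le> \<delta> * K ^ (Suc n + 2)"
      show "lin_bound r (\<Gamma> * (r / \<delta>) powr \<eta>)"
      proof (cases "r \<le> \<delta> * K\<^sup>2")
        case False
        define d where "d = r / K"
        define Y where "Y = \<Gamma> * (r / \<delta>) powr \<eta>"
        define Y1 where "Y1 = \<Gamma> * (d / \<delta>) powr \<eta>"
        define X where "X = decouple_const ^ (m + 1) * Y powr (1 - \<alpha> ^ m)"
        have r0: "0 < r" using r \<delta> by simp
        have "\<delta> * K \<le> d" using False K by (simp add: d_def field_simps power2_eq_square)
        moreover have "\<delta> * 4 \<le> \<delta> * K" using K \<delta> by (intro mult_left_mono) auto
        ultimately have d: "2 * \<delta> \<le> d" "\<delta> \<le> d" using \<delta> by linarith+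
        have d1: "d \<le> 1" "d \<le> r" using r r0 K by (auto simp: d_def field_simps intro: order_trans)
        have "d \<le> \<delta> * K ^ (n + 2)" using r(3) K by (simp add: d_def field_simps)
        then have lin: "lin_bound d Y1" using Suc d d1 by (simp add: Y1_def)
        have Y_1: "1 \<le> Y" "\<Gamma> \<le> Y"
        proof -
          have "1 \<le> (r / \<delta>) powr \<eta>" using \<eta> r \<delta> by (intro ge_one_powr_ge_zero) auto
          then have "\<Gamma> * 1 \<le> Y" unfolding Y_def using \<Gamma> by (intro mult_left_mono) auto
          then show "1 \<le> Y" "\<Gamma> \<le> Y" using \<Gamma> by auto
        qed
        have Y1: "0 \<le> Y1" "2 * 4 ^ 6 * Y1 \<le> Y"
        proof -
          show "0 \<le> Y1" using \<Gamma> by (simp add: Y1_def)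
          then have "2 * 4 ^ 6 * Y1 \<le> K powr \<eta> * Y1" using h2 by (intro mult_right_mono)
          also have "\<dots> = \<Gamma> * (K powr \<eta> * (d / \<delta>) powr \<eta>)" by (simp add: Y1_def)
          also have "K powr \<eta> * (d / \<delta>) powr \<eta> = (K * (d / \<delta>)) powr \<eta>"
            by (rule powr_mult[symmetric])
          also have "K * (d / \<delta>) = r / \<delta>" using K by (simp add: d_def)
          finally show "2 * 4 ^ 6 * Y1 \<le> Y" by (simp add: Y_def)
        qed
        \<comment> \<open>The larger constant Y of scale r is used in place of Y1, so that the
          closing inequality involves Y alone.\<close>
        have "bil_bound d d (d / K) X"
          unfolding X_def
          by (intro bil_bound_iterate K d d1 m Y_1 lin_bound_mono[OF lin]) (use Y1 in auto)
        then have "lin_bound r (4 ^ 6 * Y1 + (2 * K) ^ 17 * X)"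
          using lin Y1 Y_1 decouple_const_ge_1 unfolding d_def
          by (intro lin_bound_step K r0 r) (auto simp: X_def)
        moreover have "2 * ((2 * K) ^ 17 * X) \<le> Y"
        proof -
          have "2 * ((2 * K) ^ 17 * X) = 2 * ((2 * K) ^ 17 * decouple_const ^ (m + 1)) * Y powr (1 - \<alpha> ^ m)"
            by (simp add: X_def)
          also have "\<dots> \<le> \<Gamma> powr (\<alpha> ^ m) * Y powr (1 - \<alpha> ^ m)" using h3 by (intro mult_right_mono) auto
          also have "\<dots> \<le> Y powr (\<alpha> ^ m) * Y powr (1 - \<alpha> ^ m)"
            using Y_1 \<Gamma> alpha by (intro mult_right_mono powr_mono2) auto
          also have "\<dots> = Y" using Y_1 by (simp flip: powr_add)
          finally show ?thesis .
        qed
        ultimately show ?thesis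
          unfolding Y_def[symmetric] using Y1 by (elim lin_bound_mono) auto
      qed (use base r in auto)
    qed
  qed
  moreover obtain n where "1 / \<delta> < K ^ n" using real_arch_pow[of K "1 / \<delta>"] K by auto
  ultimately show ?thesis
  proof -
    assume *: "\<And>n. \<forall>r. \<delta> \<le> r \<longrightarrow> r \<le> 1 \<longrightarrow> r \<le> \<delta> * K ^ (n + 2) \<longrightarrow> lin_bound r (\<Gamma> * (r / \<delta>) powr \<eta>)"
    assume "1 / \<delta> < K ^ n"
    then have "1 \<le> \<delta> * K ^ n" using \<delta> by (simp add: field_simps)
    also have "\<dots> \<le> \<delta> * K ^ (n + 2)" using K \<delta> by (intro mult_left_mono power_increasing) auto
    finally show ?thesis using * r by (meson order_trans)
  qed
qed

end

section \<open>Choice of parameters\<close>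

text \<open>Put l = ln (1/\<delta>), x = l^\<sigma> and y = l^(1 - \<sigma>), so x y = l. With ln K
  about x and 2 ^ m about y the iteration reaches \<delta>, while ln \<Gamma> and \<eta> l are O(y
  ln l). The estimates use 0 < \<sigma> < 1/4 uniformly, so Kc does not depend on p. B takes up any
  prefactor.\<close>

lemma parameter_choice:
  obtains Kc :: real where "1 \<le> Kc" and "\<And>p \<delta> :: real. 4 < p \<Longrightarrow> p < 6 \<Longrightarrow> 0 < \<delta> \<Longrightarrow> \<delta> < exp (-3) \<Longrightarrow>
    \<exists>K m \<eta> \<Gamma>. 4 \<le> K \<and> (4 / K) ^ (2 ^ m) \<le> \<delta> \<and> 0 \<le> \<eta> \<and> 8 * K ^ 6 \<le> \<Gamma> \<and> 2 * 4 ^ 6 \<le> K powr \<eta>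
      \<and> 2 * ((2 * K) ^ 17 * decouple_const ^ (m + 1)) \<le> \<Gamma> powr ((2 / (p - 2)) ^ m)
      \<and> B * (\<Gamma> * (1 / \<delta>) powr \<eta>) \<le> exp (Kc * ln (1 / \<delta>) powr (1 - sigma_exp p) * ln (ln (1 / \<delta>)) powr Kc)"
proof -
  define lC where "lC = ln decouple_const"
  have lC: "0 \<le> lC" using decouple_const_ge_1 by (simp add: lC_def)
  define B' where "B' = max 1 B"
  \<comment> \<open>103 = 1 + 17 * 6 bounds the terms ln 2 and 17 ln (2 K) of W, and 4 lC those from
    \<open>decouple_const\<close>. In Kc the summands pay for B, for ln \<Gamma>, and for \<eta> l,
    with 8192 = 2 ^ 13.\<close>
  define D where "D = 103 + 4 * lC"
  define Kc where "Kc = ln B' + 2 * D + 13"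
  have lnB: "0 \<le> ln B'" by (simp add: B'_def)
  have Kc: "1 \<le> Kc" using lnB lC by (simp add: Kc_def D_def)
  show thesis
  proof
    show "1 \<le> Kc" by (rule Kc)
    fix p \<delta> :: real
    assume p: "4 < p" "p < 6" and \<delta>: "0 < \<delta>" "\<delta> < exp (-3)"
    define l where "l = ln (1 / \<delta>)"
    have "ln \<delta> < -3" using \<delta> by (metis ln_exp ln_less_cancel_iff exp_gt_zero)
    then have l: "3 \<le> l" using \<delta> by (simp add: l_def ln_div)
    have \<delta>_l: "\<delta> = exp (- l)" using \<delta> by (simp add: l_def ln_div)
    \<comment> \<open>l \<ge> 3 exceeds e; having ln l at least 1 later allows its power to be
      raised to Kc.\<close>
    have lnl: "1 \<le> ln l"
    proof -
      have "exp 1 \<le> l" using exp_le l by linarith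
      then show ?thesis using l by (simp add: ln_ge_iff)
    qed
    define \<gamma> where "\<gamma> = log 2 ((p - 2) / 2)"
    define \<sigma> where "\<sigma> = sigma_exp p"
    have \<gamma>: "0 < \<gamma>" "\<gamma> < 1" using p by (auto simp: \<gamma>_def)
    have "\<sigma> = 1/4 * (1 - \<gamma>)" by (simp only: \<gamma>_def \<sigma>_def sigma_exp_def)
    then have \<gamma>\<sigma>: "\<gamma> = 1 - 4 * \<sigma>" by argo
    have \<sigma>: "0 < \<sigma>" "\<sigma> < 1/4" using \<gamma> \<gamma>\<sigma> by auto
    define x where "x = l powr \<sigma>"
    define y where "y = l powr (1 - \<sigma>)"
    have x1: "1 \<le> x" unfolding x_def using l \<sigma> by (intro ge_one_powr_ge_zero) auto
    have y1: "1 \<le> y" unfolding y_def using l \<sigma> by (intro ge_one_powr_ge_zero) auto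
    have xy: "x * y = l" unfolding x_def y_def using l by (simp flip: powr_add)
    have y_le: "y \<le> l" using mult_right_mono[OF x1, of y] y1 xy by simp
    \<comment> \<open>Rounding up keeps 2 ^ m between y and 2 y.\<close>
    define m where "m = nat \<lceil>log 2 y\<rceil>"
    have m: "log 2 y \<le> real m" "real m \<le> log 2 y + 1"
      using y1 unfolding m_def by (auto simp: of_nat_nat)
    have pow_m: "2 ^ m = 2 powr real m" by (simp add: powr_realpow)
    have m1: "y \<le> 2 ^ m"
    proof -
      have "y = 2 powr (log 2 y)" using y1 by simp
      also have "\<dots> \<le> 2 powr real m" using m by (intro powr_mono) auto
      finally show ?thesis by (simp add: pow_m)
    qed
    have m2: "2 ^ m \<le> 2 * y"
    proof -
      have "2 powr real m \<le> 2 powr (log 2 y + 1)" using m by (intro powr_mono) auto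
      also have "\<dots> = 2 * y" using y1 by (simp add: powr_add)
      finally show ?thesis by (simp add: pow_m)
    qed
    \<comment> \<open>The factor 16 ensures 4 / K \<le> exp (- x), whose 2 ^ m-th power is at most
      exp (- x y) = \<delta>.\<close>
    define K where "K = 16 * exp x"
    have K: "4 \<le> K" using x1 exp_ge_add_one_self[of x] unfolding K_def by linarith
    have lnK: "ln K = ln 16 + x" by (simp add: K_def ln_mult)
    have "ln (exp (1/2::real)) \<le> ln 2"
      using exp_bound_half[of "1/2::real"] by (subst ln_le_cancel_iff) auto
    then have ln2: "ln 2 \<le> (1::real)" "1/2 \<le> ln (2::real)"
      using ln_le_minus_one[of "2::real"] by auto
    have ln16: "ln (16::real) = 4 * ln 2" using ln_realpow[of 2 4] by simp
    have ln8192: "ln (8192::real) = 13 * ln 2" using ln_realpow[of 2 13] by simp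
    \<comment> \<open>Makes \<open>K powr \<eta>\<close> exactly 8192 = 2 * 4 ^ 6.\<close>
    define \<eta> where "\<eta> = ln 8192 / ln K"
    have lnK_x: "x \<le> ln K" using ln2 by (simp add: lnK ln16)
    have \<eta>: "0 \<le> \<eta>" using lnK_x x1 by (simp add: \<eta>_def)
    \<comment> \<open>W is the logarithm of the left side of the last condition on \<Gamma>. As 2 /
      (p - 2) = 2 powr (- \<gamma>) and 2 ^ m \<le> 2 y, the exponent there is at least (2 y) powr
      (- \<gamma>), for which G compensates.\<close>
    define W where "W = ln 2 + 17 * ln (2 * K) + real (m + 1) * lC"
    define G where "G = (2 * y) powr \<gamma> * W"
    define \<Gamma> where "\<Gamma> = exp G"
    have ln2K: "0 \<le> ln (2 * K)" using K by simp
    have W0: "0 \<le> W" unfolding W_def using lC ln2 ln2K by (intro add_nonneg_nonneg mult_nonneg_nonneg) auto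
    have expW: "exp W = 2 * ((2 * K) ^ 17 * decouple_const ^ (m + 1))"
    proof -
      have "exp (17 * ln (2 * K)) = (2 * K) ^ 17" using K exp_of_nat_mult[of 17 "ln (2 * K)"] by simp
      moreover have "exp (real (m + 1) * lC) = decouple_const ^ (m + 1)"
        using decouple_const_ge_1 by (simp only: exp_of_nat_mult lC_def) simp
      ultimately show ?thesis by (simp only: W_def exp_add) simp
    qed
    have y\<gamma>: "1 \<le> (2 * y) powr \<gamma>" using y1 \<gamma> by (intro ge_one_powr_ge_zero) auto
    have WG: "W \<le> G" using mult_right_mono[OF y\<gamma> W0] by (simp add: G_def)
    have c1: "(4 / K) ^ (2 ^ m) \<le> \<delta>"
    proof -
      have "(4 / K) ^ (2 ^ m) \<le> exp (- x) ^ (2 ^ m)"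
        using K by (intro power_mono) (auto simp: K_def exp_minus field_simps)
      also have "\<dots> = exp (- (2 ^ m * x))" by (simp flip: exp_of_nat_mult)
      also have "\<dots> \<le> exp (- l)" using mult_left_mono[OF m1, of x] x1 xy by (simp add: mult.commute)
      finally show ?thesis by (simp add: \<delta>_l)
    qed
    have c2: "8 * K ^ 6 \<le> \<Gamma>"
    proof -
      have "8 * K ^ 6 \<le> (2 * K) ^ 6" by (simp add: power_mult_distrib)
      also have "\<dots> \<le> (2 * K) ^ 17" using K by (intro power_increasing) auto
      also have "\<dots> \<le> exp W"
      proof -
        have "(2 * K) ^ 17 * 1 \<le> (2 * K) ^ 17 * decouple_const ^ (m + 1)"
          using K decouple_const_ge_1 by (intro mult_left_mono one_le_power) auto
        moreover have "0 \<le> (2 * K) ^ 17" using K by simp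
        ultimately show ?thesis unfolding expW by linarith
      qed
      also have "\<dots> \<le> \<Gamma>" using WG by (simp add: \<Gamma>_def)
      finally show ?thesis .
    qed
    have c3: "2 * 4 ^ 6 \<le> K powr \<eta>"
      using K lnK_x x1 by (simp add: powr_def \<eta>_def)
    have c4: "2 * ((2 * K) ^ 17 * decouple_const ^ (m + 1)) \<le> \<Gamma> powr ((2 / (p - 2)) ^ m)"
    proof -
      have a: "2 / (p - 2) = 2 powr (- \<gamma>)" using p by (simp add: \<gamma>_def powr_minus field_simps)
      have "(2 / (p - 2)) ^ m = (2 ^ m) powr (- \<gamma>)"
        unfolding a by (simp add: powr_powr pow_m powr_realpow[symmetric] mult.commute)
      also have "\<dots> \<ge> (2 * y) powr (- \<gamma>)" using m2 \<gamma> y1 by (intro powr_mono2') auto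
      finally have "(2 * y) powr (- \<gamma>) * G \<le> (2 / (p - 2)) ^ m * G" using W0 WG by (intro mult_right_mono) auto
      moreover have "(2 * y) powr (- \<gamma>) * G = W" using y1 by (simp add: G_def powr_minus)
      ultimately have "exp W \<le> exp ((2 / (p - 2)) ^ m * G)" by simp
      then show ?thesis by (simp add: expW \<Gamma>_def powr_def mult.commute)
    qed
    have c5: "B * (\<Gamma> * (1 / \<delta>) powr \<eta>) \<le> exp (Kc * l powr (1 - \<sigma>) * ln l powr Kc)"
    proof -
      have "\<eta> * l \<le> 13 * y"
      proof -
        have "\<eta> \<le> 13 / x"
        proof -
          have "\<eta> \<le> ln 8192 / x" unfolding \<eta>_def using lnK_x x1 by (intro divide_left_mono) auto
          also have "\<dots> \<le> 13 / x" using ln2 x1 by (intro divide_right_mono) (auto simp: ln8192)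
          finally show ?thesis .
        qed
        then have "\<eta> * l \<le> 13 / x * l" using l by (intro mult_right_mono) auto
        also have "\<dots> = 13 * y" using x1 by (simp add: xy[symmetric])
        finally show ?thesis .
      qed
      moreover have "W \<le> D * (x * ln l)"
      proof -
        have xl: "1 \<le> x * ln l" "x \<le> x * ln l" "ln l \<le> x * ln l"
          using mult_mono[OF x1 lnl] mult_left_mono[OF lnl, of x] mult_right_mono[OF x1, of "ln l"] x1 lnl by auto
        have "ln (2 * K) = ln 2 + ln K" using K by (simp add: ln_mult)
        then have "ln (2 * K) \<le> 6 * x" using ln2 x1 by (simp add: lnK ln16)
        moreover have "real (m + 1) \<le> 4 * ln l"
        proof -
          have "ln y \<le> ln l" using y_le y1 by simp
          then have "ln y / ln 2 \<le> ln l / (1/2)" using ln2 lnl y1 by (intro frac_le) auto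
          then have "log 2 y \<le> 2 * ln l" by (simp add: log_def)
          then show ?thesis using m lnl by simp
        qed
        then have "real (m + 1) * lC \<le> 4 * ln l * lC" using lC by (intro mult_right_mono)
        moreover have "4 * lC * ln l \<le> 4 * lC * (x * ln l)" using xl lC by (intro mult_left_mono) auto
        moreover have "4 * ln l * lC = 4 * lC * ln l" by simp
        ultimately have "ln 2 + 17 * ln (2 * K) + real (m + 1) * lC \<le> 103 * (x * ln l) + 4 * lC * (x * ln l)"
          using xl ln2 by argo
        then show ?thesis unfolding W_def by (simp only: D_def distrib_right)
      qed
      moreover have "G \<le> 2 * D * (y * ln l)"
      proof -
        have D0: "0 \<le> D" using lC by (simp add: D_def)
        have "(2 * y) powr \<gamma> = 2 powr \<gamma> * y powr \<gamma>" by (simp add: powr_mult)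
        also have "\<dots> \<le> 2 powr 1 * y powr \<gamma>" using \<gamma> by (intro mult_right_mono powr_mono) auto
        finally have "(2 * y) powr \<gamma> \<le> 2 * y powr \<gamma>" by simp
        then have "G \<le> 2 * y powr \<gamma> * (D * (x * ln l))"
          unfolding G_def using \<open>W \<le> D * (x * ln l)\<close> W0 by (intro mult_mono) auto
        also have "\<dots> = 2 * D * (y powr \<gamma> * x * ln l)" by simp
        also have "\<dots> \<le> 2 * D * (y * ln l)"
        proof (intro mult_left_mono mult_right_mono)
          have "y powr \<gamma> * x = l powr ((1 - \<sigma>) * \<gamma> + \<sigma>)"
            by (simp add: y_def x_def powr_powr powr_add)
          also have "\<dots> \<le> l powr (1 - \<sigma>)"
          proof (rule powr_mono)
            \<comment> \<open>With \<gamma> = 1 - 4 \<sigma> the comparison of exponents becomes 4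
              \<sigma>^2 \<le> 3 \<sigma>.\<close>
            have "4 * (\<sigma> * \<sigma>) \<le> 3 * \<sigma>" using mult_right_mono[of "4 * \<sigma>" 3 \<sigma>] \<sigma> by simp
            then show "(1 - \<sigma>) * \<gamma> + \<sigma> \<le> 1 - \<sigma>" by (simp add: \<gamma>\<sigma> algebra_simps)
          qed (use l in auto)
          finally show "y powr \<gamma> * x \<le> y" by (simp add: y_def)
        qed (use D0 lnl in auto)
        finally show ?thesis .
      qed
      moreover have "1 \<le> y * ln l" "y \<le> y * ln l"
        using mult_mono[OF y1 lnl] mult_left_mono[OF lnl, of y] y1 by auto
      then have "ln B' * 1 \<le> ln B' * (y * ln l)" "13 * y \<le> 13 * (y * ln l)"
        using mult_left_mono[OF _ lnB, of 1 "y * ln l"] by auto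
      moreover have "Kc * (y * ln l) = ln B' * (y * ln l) + 2 * D * (y * ln l) + 13 * (y * ln l)"
        by (simp add: Kc_def distrib_right)
      ultimately have "ln B' + G + \<eta> * l \<le> Kc * (y * ln l)" by linarith
      also have "\<dots> = Kc * y * ln l powr 1" using lnl by simp
      also have "\<dots> \<le> Kc * y * ln l powr Kc"
        using Kc lnl y1 by (intro mult_left_mono powr_mono) auto
      finally have "exp (ln B' + G + \<eta> * l) \<le> exp (Kc * y * ln l powr Kc)" by simp
      moreover have "exp (ln B' + G + \<eta> * l) = B' * (\<Gamma> * (1 / \<delta>) powr \<eta>)"
        using \<delta> by (simp add: exp_add \<Gamma>_def powr_def l_def B'_def mult.commute)
      moreover have "B * (\<Gamma> * (1 / \<delta>) powr \<eta>) \<le> B' * (\<Gamma> * (1 / \<delta>) powr \<eta>)"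
        by (intro mult_right_mono) (auto simp: B'_def \<Gamma>_def)
      ultimately show ?thesis by (simp add: y_def)
    qed
    show "\<exists>K m \<eta> \<Gamma>. 4 \<le> K \<and> (4 / K) ^ (2 ^ m) \<le> \<delta> \<and> 0 \<le> \<eta> \<and> 8 * K ^ 6 \<le> \<Gamma> \<and> 2 * 4 ^ 6 \<le> K powr \<eta>
      \<and> 2 * ((2 * K) ^ 17 * decouple_const ^ (m + 1)) \<le> \<Gamma> powr ((2 / (p - 2)) ^ m)
      \<and> B * (\<Gamma> * (1 / \<delta>) powr \<eta>) \<le> exp (Kc * ln (1 / \<delta>) powr (1 - sigma_exp p) * ln (ln (1 / \<delta>)) powr Kc)"
      using K c1 \<eta> c2 c3 c4 c5 unfolding l_def \<sigma>_def by blast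
  qed
qed

section \<open>From the weight to the square\<close>

text \<open>A normalised product of two-sided exponentials. A sharp cut-off would not be comparable
  with its translates; exponential tails are.\<close>

definition decay_weight :: "real \<Rightarrow> real \<Rightarrow> real \<Rightarrow> real \<times> real \<Rightarrow> real" where
  "decay_weight L a b z = exp (- \<bar>fst z - a\<bar> / L) / (2 * L) * (exp (- \<bar>snd z - b\<bar> / L) / (2 * L))"

lemma decay_weight_measurable [measurable]: "decay_weight L a b \<in> borel_measurable borel"
  unfolding decay_weight_def borel_prod[symmetric] by measurable

lemma decay_weight_nonneg: "0 < L \<Longrightarrow> 0 \<le> decay_weight L a b z"
  by (simp add: decay_weight_def)

lemma nn_integral_exp_abs_le: "(\<integral>\<^sup>+x. ennreal (exp (- \<bar>x::real\<bar>)) \<partial>lborel) \<le> 2"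
proof -
  have 1: "(\<integral>\<^sup>+x. ennreal (exponential_density 1 x) \<partial>lborel) = 1"
  proof -
    interpret prob_space "density lborel (exponential_density 1)" by (rule prob_space_exponential_density) simp
    show ?thesis using emeasure_space_1 by (simp add: emeasure_density)
  qed
  moreover have "(\<integral>\<^sup>+x. ennreal (exponential_density 1 x) \<partial>lborel) = (\<integral>\<^sup>+x. ennreal (exponential_density 1 (- x)) \<partial>lborel)"
    using nn_integral_real_affine[of "\<lambda>x. ennreal (exponential_density 1 x)" "-1" 0] by simp
  ultimately have 2: "(\<integral>\<^sup>+x. ennreal (exponential_density 1 (- x)) \<partial>lborel) = 1" by simp
  have "(\<integral>\<^sup>+x. ennreal (exp (- \<bar>x::real\<bar>)) \<partial>lborel)
     \<le> (\<integral>\<^sup>+x. ennreal (exponential_density 1 x) + ennreal (exponential_density 1 (- x)) \<partial>lborel)"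
    by (intro nn_integral_mono) (auto simp: exponential_density_def ennreal_plus[symmetric] intro!: ennreal_leI simp del: ennreal_plus)
  also have "\<dots> = 1 + 1" by (subst nn_integral_add) (simp_all add: 1 2)
  finally show ?thesis by (simp add: one_add_one)
qed

lemma nn_integral_exp_abs_affine_le:
  fixes a L :: real assumes "0 < L"
  shows "(\<integral>\<^sup>+x. ennreal (exp (- \<bar>x - a\<bar> / L) / (2 * L)) \<partial>lborel) \<le> 1"
proof -
  have "(\<integral>\<^sup>+x. ennreal (exp (- \<bar>x - a\<bar> / L) / (2 * L)) \<partial>lborel)
      = ennreal L * (\<integral>\<^sup>+x. ennreal (exp (- \<bar>(a + L * x) - a\<bar> / L) / (2 * L)) \<partial>lborel)"
    using assms nn_integral_real_affine[of "\<lambda>x. ennreal (exp (- \<bar>x - a\<bar> / L) / (2 * L))" L a] by simp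
  also have "\<dots> = ennreal L * (\<integral>\<^sup>+x. ennreal (1 / (2 * L)) * ennreal (exp (- \<bar>x\<bar>)) \<partial>lborel)"
    using assms by (simp add: abs_mult ennreal_mult[symmetric])
  also have "\<dots> = ennreal (1 / 2) * (\<integral>\<^sup>+x. ennreal (exp (- \<bar>x\<bar>)) \<partial>lborel)"
    using assms by (subst nn_integral_cmult) (auto simp: mult.assoc[symmetric] ennreal_mult[symmetric])
  also have "\<dots> \<le> ennreal (1 / 2) * 2" by (intro mult_left_mono nn_integral_exp_abs_le) simp
  also have "\<dots> = ennreal (1 / 2 * 2)" by (subst ennreal_mult) simp_all
  finally show ?thesis by simp
qed

lemma nn_integral_decay_weight_le:
  assumes "0 < L" shows "(\<integral>\<^sup>+z. ennreal (decay_weight L a b z) \<partial>lborel) \<le> 1"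
proof -
  have "(\<integral>\<^sup>+z. ennreal (decay_weight L a b z) \<partial>lborel) = (\<integral>\<^sup>+z. ennreal (decay_weight L a b z) \<partial>(lborel \<Otimes>\<^sub>M lborel))"
    by (simp add: lborel_prod)
  also have "\<dots> = (\<integral>\<^sup>+x. \<integral>\<^sup>+y. ennreal (decay_weight L a b (x, y)) \<partial>lborel \<partial>lborel)"
    by (rule lborel.nn_integral_fst[symmetric]) (simp add: lborel_prod)
  also have "\<dots> = (\<integral>\<^sup>+x. ennreal (exp (- \<bar>x - a\<bar> / L) / (2 * L)) * (\<integral>\<^sup>+y. ennreal (exp (- \<bar>y - b\<bar> / L) / (2 * L)) \<partial>lborel) \<partial>lborel)"
    unfolding decay_weight_def fst_conv snd_conv using assms
    by (intro nn_integral_cong, subst nn_integral_cmult[symmetric], measurable) (intro nn_integral_cong ennreal_mult, auto)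
  also have "\<dots> \<le> (\<integral>\<^sup>+x. ennreal (exp (- \<bar>x - a\<bar> / L) / (2 * L)) * 1 \<partial>lborel)"
    by (intro nn_integral_mono mult_left_mono nn_integral_exp_abs_affine_le assms) simp
  also have "\<dots> \<le> 1" using nn_integral_exp_abs_affine_le[OF assms] by simp
  finally show ?thesis .
qed

text \<open>By the triangle inequality each of the two coordinates costs a factor
  \<open>exp (norm v / L)\<close>.\<close>

lemma decay_weight_translate_le:
  assumes "0 < L" shows "decay_weight L a b (z - v) \<le> exp (2 / L * norm v) * decay_weight L a b z"
proof -
  have le: "exp (- \<bar>x - s - c\<bar> / L) \<le> exp (norm v / L) * exp (- \<bar>x - c\<bar> / L)" if "\<bar>s\<bar> \<le> norm v" for x s c :: real
  proof -
    have "- \<bar>x - s - c\<bar> \<le> norm v + - \<bar>x - c\<bar>" using that by linarith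
    then have "- \<bar>x - s - c\<bar> / L \<le> (norm v + - \<bar>x - c\<bar>) / L" using assms by (intro divide_right_mono) auto
    then show ?thesis by (simp add: exp_add[symmetric] add_divide_distrib diff_divide_distrib)
  qed
  have v: "\<bar>fst v\<bar> \<le> norm v" "\<bar>snd v\<bar> \<le> norm v"
    using norm_fst_le[of "fst v" "snd v"] norm_snd_le[of "snd v" "fst v"] by simp_all
  have "decay_weight L a b (z - v)
     \<le> exp (norm v / L) * exp (- \<bar>fst z - a\<bar> / L) / (2 * L) * (exp (norm v / L) * exp (- \<bar>snd z - b\<bar> / L) / (2 * L))"
    unfolding decay_weight_def fst_diff snd_diff using assms
    by (intro mult_mono divide_right_mono le v) auto
  also have "\<dots> = (exp (norm v / L) * exp (norm v / L)) * decay_weight L a b z"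
    by (simp add: decay_weight_def mult_ac)
  also have "exp (norm v / L) * exp (norm v / L) = exp (2 / L * norm v)" by (simp flip: exp_add)
  finally show ?thesis .
qed

lemma quasi_invariant_decay_weight:
  assumes "0 < L" shows "quasi_invariant (density lborel (\<lambda>z. ennreal (decay_weight L a b z))) (2 / L)"
proof
  show "sets (density lborel (\<lambda>z. ennreal (decay_weight L a b z))) = sets borel" by simp
  show "emeasure (density lborel (\<lambda>z. ennreal (decay_weight L a b z))) (space (density lborel (\<lambda>z. ennreal (decay_weight L a b z)))) \<le> 1"
    using nn_integral_decay_weight_le[OF assms] by (simp add: emeasure_density)
  fix F :: "real \<times> real \<Rightarrow> ennreal" and v :: "real \<times> real"
  assume [measurable]: "F \<in> borel_measurable borel"
  define G where "G z = ennreal (decay_weight L a b (z - v)) * F z" for z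
  have [measurable]: "G \<in> borel_measurable borel" unfolding G_def by measurable
  have "(\<integral>\<^sup>+z. F (z + v) \<partial>density lborel (\<lambda>z. ennreal (decay_weight L a b z))) = (\<integral>\<^sup>+z. G (v + z) \<partial>lborel)"
    by (subst nn_integral_density) (auto simp: G_def add.commute)
  also have "\<dots> = (\<integral>\<^sup>+z. G z \<partial>distr lborel borel ((+) v))" by (subst nn_integral_distr) auto
  also have "\<dots> = (\<integral>\<^sup>+z. G z \<partial>lborel)" by (simp add: lborel_distr_plus)
  also have "\<dots> \<le> (\<integral>\<^sup>+z. ennreal (exp (2 / L * norm v)) * (ennreal (decay_weight L a b z) * F z) \<partial>lborel)"
  proof (rule nn_integral_mono)
    fix z
    have "ennreal (decay_weight L a b (z - v)) \<le> ennreal (exp (2 / L * norm v) * decay_weight L a b z)"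
      by (intro ennreal_leI decay_weight_translate_le assms)
    then have "G z \<le> ennreal (exp (2 / L * norm v) * decay_weight L a b z) * F z"
      unfolding G_def by (intro mult_right_mono) auto
    then show "G z \<le> ennreal (exp (2 / L * norm v)) * (ennreal (decay_weight L a b z) * F z)"
      by (simp add: ennreal_mult' decay_weight_nonneg[OF assms] mult.assoc)
  qed
  also have "\<dots> = ennreal (exp (2 / L * norm v)) * (\<integral>\<^sup>+z. F z \<partial>density lborel (\<lambda>z. ennreal (decay_weight L a b z)))"
    by (subst nn_integral_density) (auto simp: nn_integral_cmult)
  finally show "(\<integral>\<^sup>+z. F (z + v) \<partial>density lborel (\<lambda>z. ennreal (decay_weight L a b z)))
     \<le> ennreal (exp (2 / L * norm v)) * (\<integral>\<^sup>+z. F z \<partial>density lborel (\<lambda>z. ennreal (decay_weight L a b z)))" .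
qed

lemma measure_axis_square: "0 \<le> L \<Longrightarrow> measure lborel (axis_square L u v) = L\<^sup>2"
proof -
  assume "0 \<le> L"
  moreover have "axis_square L u v = cbox (u, v) (u + L, v + L)" by (simp add: axis_square_def cbox_Pair_eq)
  ultimately show ?thesis by (simp add: content_Pair power2_eq_square)
qed

text \<open>On the square each coordinate is within L/2 of the centre, so both exponentials are at
  least exp (-1/2); 4 L^2 undoes the normalisation.\<close>

lemma indicator_axis_square_le:
  assumes L: "0 < L"
  shows "indicator (axis_square L u v) z \<le> 4 * exp 1 * L\<^sup>2 * decay_weight L (u + L/2) (v + L/2) z"
proof (cases "z \<in> axis_square L u v")
  case True
  have *: "exp (- 1 / 2) \<le> exp (- \<bar>x - (c + L/2)\<bar> / L)" if "c \<le> x" "x \<le> c + L" for x c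
  proof -
    have "\<bar>x - (c + L/2)\<bar> \<le> L / 2" using that by argo
    then have "\<bar>x - (c + L/2)\<bar> / L \<le> 1 / 2" using L by (simp add: field_simps)
    then show ?thesis by simp
  qed
  have "exp (- 1/2) * exp (- 1/2) \<le> exp (- \<bar>fst z - (u + L/2)\<bar> / L) * exp (- \<bar>snd z - (v + L/2)\<bar> / L)"
    using True by (intro mult_mono *) (auto simp: axis_square_def)
  moreover have "exp (- 1/2) * exp (- 1/2) = exp (- 1 :: real)" by (simp flip: exp_add)
  ultimately have "exp 1 * exp (- 1) \<le> exp 1 * (exp (- \<bar>fst z - (u + L/2)\<bar> / L) * exp (- \<bar>snd z - (v + L/2)\<bar> / L))"
    by simp
  also have "exp 1 * exp (- 1) = (1::real)" by (simp flip: exp_add)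
  finally show ?thesis using True L by (simp add: decay_weight_def power2_eq_square)
qed (use decay_weight_nonneg[OF L] in simp)

section \<open>From short arcs to the circle and from the weight to the average\<close>

context decoupling
begin

text \<open>The linear bound reaches diameter 1, so the full range of angles is cut into at most 10
  cells. Of the factor \<open>10 ^ 7\<close>, six powers come from the power inequality with p < 6
  and one from the number of cells.\<close>

lemma nn_integral_esum_le:
  assumes fin: "finite S" and sep: "\<And>a b. a \<in> S \<Longrightarrow> b \<in> S \<Longrightarrow> a \<noteq> b \<Longrightarrow> \<delta> \<le> \<bar>a - b\<bar>"
    and S: "S \<subseteq> {0..<2 * pi}" and lin: "lin_bound 1 Y" and Y: "0 \<le> Y"
  shows "(\<integral>\<^sup>+z. ennreal (norm (esum S c z) powr p) \<partial>\<mu>) \<le> ennreal (10 ^ 7 * Y * energy S c powr (p/2))"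
proof -
  have fc: "finite (cells S 1)" by (rule finite_cells[OF fin])
  have adm: "adm S (2 * pi)"
  proof (rule admI[OF fin sep])
    fix a b assume "a \<in> S" "b \<in> S"
    then have "0 \<le> a" "a < 2 * pi" "0 \<le> b" "b < 2 * pi" using S by auto
    then show "\<bar>a - b\<bar> \<le> 2 * pi" by linarith
  qed
  have "real (card (cells S 1)) \<le> 2 * pi / 1 + 2"
    by (rule card_cells_le[OF fin _ _ admD(3)[OF adm]]) auto
  then have card: "real (card (cells S 1)) \<le> 10" using pi_less_4 by simp
  have "norm (esum S c z) powr p \<le> 10 ^ 6 * (\<Sum>k\<in>cells S 1. norm (esum (piece S 1 k) c z) powr p)" for z
  proof -
    have "norm (esum S c z) powr p \<le> 10 powr p * (\<Sum>k\<in>cells S 1. norm (esum (piece S 1 k) c z) powr p)"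
      unfolding esum_pieces[OF fin, of c z 1] using p
      by (intro powr_le_card_powr_sum fc card norm_sum) auto
    also have "\<dots> \<le> 10 ^ 6 * (\<Sum>k\<in>cells S 1. norm (esum (piece S 1 k) c z) powr p)"
    proof (rule mult_right_mono)
      have "(10::real) powr p \<le> 10 powr 6" using p by (intro powr_mono) auto
      then show "(10::real) powr p \<le> 10 ^ 6" using powr_realpow[of 10 6] by simp
    qed (simp add: sum_nonneg)
    finally show ?thesis .
  qed
  then have "(\<integral>\<^sup>+z. ennreal (norm (esum S c z) powr p) \<partial>\<mu>)
      \<le> (\<integral>\<^sup>+z. ennreal (10 ^ 6 * (\<Sum>k\<in>cells S 1. norm (esum (piece S 1 k) c z) powr p)) \<partial>\<mu>)"
    by (intro nn_integral_mono ennreal_leI)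
  also have "\<dots> \<le> ennreal (10 ^ 6 * (\<Sum>k\<in>cells S 1. Y * energy S c powr (p/2)))"
  proof (intro nn_integral_cmult_le nn_integral_sum_le fc)
    fix k
    have "(\<integral>\<^sup>+z. ennreal (norm (esum (piece S 1 k) c z) powr p) \<partial>\<mu>) \<le> ennreal (Y * energy (piece S 1 k) c powr (p/2))"
      by (intro lin_boundD[OF lin] adm_piece[OF adm]) simp
    also have "\<dots> \<le> ennreal (Y * energy S c powr (p/2))"
      using Y p energy_mono[OF fin piece_subset]
      by (intro ennreal_leI mult_left_mono powr_mono2) (auto simp: energy_nonneg)
    finally show "(\<integral>\<^sup>+z. ennreal (norm (esum (piece S 1 k) c z) powr p) \<partial>\<mu>) \<le> ennreal (Y * energy S c powr (p/2))" .
  qed (use Y in \<open>auto intro: sum_nonneg\<close>)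
  also have "\<dots> \<le> ennreal (10 ^ 6 * (10 * (Y * energy S c powr (p/2))))"
    using mult_right_mono[OF card, of "Y * energy S c powr (p/2)"] Y by (intro ennreal_leI mult_left_mono) auto
  finally show ?thesis by (simp add: mult.assoc)
qed

end

text \<open>A half-open period gives each point of the circle one angle, recovered by
  \<open>Arg2pi\<close>.\<close>

lemma exp_sum_eq_esum:
  assumes "A \<subseteq> {(x, y). x\<^sup>2 + y\<^sup>2 = 1}"
  obtains S where "S \<subseteq> {0..<2 * pi}" "A = dir ` S" "inj_on dir S" "\<And>z. exp_sum A z = esum S (\<lambda>_. 1) z"
proof -
  define S where "S = {\<theta> \<in> {0..<2 * pi}. dir \<theta> \<in> A}"
  have A: "A = dir ` S"
  proof
    show "A \<subseteq> dir ` S"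
    proof
      fix a assume "a \<in> A"
      then have "(fst a)\<^sup>2 + (snd a)\<^sup>2 = 1" using assms by auto
      then obtain t where "0 \<le> t" "t < 2 * pi" "fst a = cos t" "snd a = sin t" by (rule sincos_total_2pi)
      then have "a = dir t" "t \<in> {0..<2 * pi}" by (simp_all add: dir_def prod_eq_iff)
      then show "a \<in> dir ` S" using \<open>a \<in> A\<close> by (auto simp: S_def)
    qed
  qed (auto simp: S_def)
  have inj: "inj_on dir S"
  proof (rule inj_onI)
    fix s t assume st: "s \<in> S" "t \<in> S" "dir s = dir t"
    then have "cis s = cis t" by (simp add: dir_def complex_eq_iff)
    then have "Arg2pi (cis s) = Arg2pi (cis t)" by simp
    moreover have "Arg2pi (cis r) = r" if "r \<in> S" for r
      using that by (intro Arg2pi_unique[of 1]) (auto simp: S_def cis_conv_exp)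
    ultimately show "s = t" using st by simp
  qed
  show thesis
  proof
    show "S \<subseteq> {0..<2 * pi}" by (auto simp: S_def)
    show "A = dir ` S" by (rule A)
    show "inj_on dir S" by (rule inj)
    show "exp_sum A z = esum S (\<lambda>_. 1) z" for z
      unfolding exp_sum_def esum_def A sum.reindex[OF inj]
      by (intro sum.cong refl) (simp add: cis_conv_exp mult_ac)
  qed
qed

text \<open>A chord is at most its arc, so separation in the plane passes to the angles.\<close>

lemma dist_dir_le: "dist (dir a) (dir b) \<le> \<bar>a - b\<bar>"
proof -
  have "(norm (dir a - dir b))\<^sup>2 = 2 * (1 - cos (a - b))"
    by (simp add: power2_norm_eq_inner inner_diff_left inner_diff_right inner_dir_dir inner_commute)
  also have "\<dots> \<le> \<bar>a - b\<bar>\<^sup>2" using one_minus_cos_le[of "a - b"] by simp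
  finally show ?thesis unfolding dist_norm by (rule power2_le_imp_le) simp
qed

lemma Lp_avg_exp_sum_le:
  fixes p \<delta> L K \<eta> \<Gamma> :: real
  assumes p: "4 < p" "p < 6" and d: "0 < \<delta>" "\<delta> \<le> 1" and L: "0 < L" "2 / L \<le> \<delta>\<^sup>2 / 4"
    and K: "4 \<le> K" "(4 / K) ^ (2 ^ m) \<le> \<delta>" "0 \<le> \<eta>" "8 * K ^ 6 \<le> \<Gamma>" "2 * 4 ^ 6 \<le> K powr \<eta>"
      "2 * ((2 * K) ^ 17 * decouple_const ^ (m + 1)) \<le> \<Gamma> powr ((2 / (p - 2)) ^ m)"
    and A: "A \<subseteq> {(x, y). x\<^sup>2 + y\<^sup>2 = 1}" and sep: "\<forall>a\<in>A. \<forall>b\<in>A. a \<noteq> b \<longrightarrow> \<delta> \<le> dist a b"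
  shows "Lp_avg p (axis_square L u v) (exp_sum A) \<le> 4 * exp 1 * 10 ^ 7 * (\<Gamma> * (1 / \<delta>) powr \<eta>) * sqrt (real (card A))"
proof (cases "finite A")
  \<comment> \<open>Sums over infinite sets and their cardinalities are 0 by convention, so both
    sides vanish.\<close>
  case False
  then show ?thesis by (simp add: Lp_avg_def exp_sum_def)
next
  case True
  define a where "a = u + L / 2"
  define b where "b = v + L / 2"
  define B where "B = axis_square L u v"
  interpret quasi_invariant "density lborel (\<lambda>z. ennreal (decay_weight L a b z))" "2 / L"
    by (rule quasi_invariant_decay_weight[OF L(1)])
  interpret decoupling "density lborel (\<lambda>z. ennreal (decay_weight L a b z))" "2 / L" \<delta> p
    by unfold_locales (use p d L in auto)
  obtain S where S: "S \<subseteq> {0..<2 * pi}" "A = dir ` S" "inj_on dir S" "\<And>z. exp_sum A z = esum S (\<lambda>_. 1) z"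
    using exp_sum_eq_esum[OF A] by blast
  have fin: "finite S" using True S(2,3) by (simp add: finite_image_iff)
  have cardS: "card S = card A" using S(2,3) by (simp add: card_image)
  have sepS: "\<delta> \<le> \<bar>s - t\<bar>" if "s \<in> S" "t \<in> S" "s \<noteq> t" for s t
  proof -
    have "dir s \<noteq> dir t" using that S(3) by (auto dest: inj_onD)
    then have "\<delta> \<le> dist (dir s) (dir t)" using sep that S(2) by auto
    then show ?thesis using dist_dir_le[of s t] by simp
  qed
  define Y where "Y = \<Gamma> * (1 / \<delta>) powr \<eta>"
  have "lin_bound 1 Y"
    unfolding Y_def using d K by (intro lin_bound_main[of K m]) (auto simp: \<alpha>_def q_def)
  have G1: "1 \<le> \<Gamma>" using K one_le_power[of K 6] by linarith
  have "1 \<le> (1 / \<delta>) powr \<eta>" using K d by (intro ge_one_powr_ge_zero) auto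
  with G1 have "1 * 1 \<le> \<Gamma> * (1 / \<delta>) powr \<eta>" by (intro mult_mono) auto
  then have Y: "1 \<le> Y" by (simp add: Y_def)
  define n where "n = real (card A)"
  define R where "R = 10 ^ 7 * Y * n powr (p/2)"
  have R: "0 \<le> R" using Y by (simp add: R_def)
  have "energy S (\<lambda>_. 1) = n" by (simp add: energy_def n_def cardS)
  then have bound: "(\<integral>\<^sup>+z. ennreal (norm (exp_sum A z) powr p) \<partial>density lborel (\<lambda>z. ennreal (decay_weight L a b z))) \<le> ennreal R"
    using nn_integral_esum_le[OF fin sepS S(1) \<open>lin_bound 1 Y\<close>, of "\<lambda>_. 1"] Y by (simp add: S(4) R_def)
  have "exp_sum A = esum S (\<lambda>_. 1)" by (rule ext) (rule S(4))
  then have [measurable]: "exp_sum A \<in> borel_measurable borel" by (simp only: esum_measurable)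
  \<comment> \<open>The indicator is replaced by a multiple of the weight; the factor L^2 lost here
    cancels against the area of the square.\<close>
  have "(\<integral>\<^sup>+z. ennreal (indicator B z *\<^sub>R (norm (exp_sum A z) powr p)) \<partial>lborel)
      \<le> (\<integral>\<^sup>+z. ennreal (4 * exp 1 * L\<^sup>2) * (ennreal (decay_weight L a b z) * ennreal (norm (exp_sum A z) powr p)) \<partial>lborel)"
  proof (rule nn_integral_mono)
    fix z
    have "indicator B z *\<^sub>R (norm (exp_sum A z) powr p) \<le> 4 * exp 1 * L\<^sup>2 * decay_weight L a b z * (norm (exp_sum A z) powr p)"
      unfolding B_def a_def b_def real_scaleR_def using L by (intro mult_right_mono indicator_axis_square_le) auto
    then have "ennreal (indicator B z *\<^sub>R (norm (exp_sum A z) powr p))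
        \<le> ennreal (4 * exp 1 * L\<^sup>2 * (decay_weight L a b z * (norm (exp_sum A z) powr p)))"
      by (intro ennreal_leI) (simp add: mult.assoc)
    also have "\<dots> = ennreal (4 * exp 1 * L\<^sup>2) * (ennreal (decay_weight L a b z) * ennreal (norm (exp_sum A z) powr p))"
      by (simp add: ennreal_mult decay_weight_nonneg[OF L(1)])
    finally show "ennreal (indicator B z *\<^sub>R (norm (exp_sum A z) powr p)) \<le> \<dots>" .
  qed
  also have "\<dots> = ennreal (4 * exp 1 * L\<^sup>2) * (\<integral>\<^sup>+z. ennreal (norm (exp_sum A z) powr p) \<partial>density lborel (\<lambda>z. ennreal (decay_weight L a b z)))"
    by (subst nn_integral_density) (auto simp: nn_integral_cmult)
  also have "\<dots> \<le> ennreal (4 * exp 1 * L\<^sup>2) * ennreal R" by (intro mult_left_mono bound) simp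
  also have "\<dots> = ennreal (4 * exp 1 * L\<^sup>2 * R)" using R by (subst ennreal_mult) auto
  finally have int: "set_lebesgue_integral lborel B (\<lambda>z. norm (exp_sum A z) powr p) \<le> 4 * exp 1 * L\<^sup>2 * R"
    unfolding set_lebesgue_integral_def using R by (intro integral_real_bounded) auto
  \<comment> \<open>Q \<ge> 1 allows its p-th root to be bounded by Q itself, which keeps the
    constant independent of p.\<close>
  define Q where "Q = 4 * exp 1 * 10 ^ 7 * Y"
  have Q: "1 \<le> Q"
  proof -
    have "(1::real) \<le> 4 * exp 1 * 10 ^ 7" using exp_ge_add_one_self[of "1::real"] by simp
    then have "1 * 1 \<le> (4 * exp 1 * 10 ^ 7) * Y" using Y by (intro mult_mono) auto
    then show ?thesis by (simp add: Q_def)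
  qed
  have "1 / measure lborel B * set_lebesgue_integral lborel B (\<lambda>z. norm (exp_sum A z) powr p) \<le> 1 / L\<^sup>2 * (4 * exp 1 * L\<^sup>2 * R)"
    using int L unfolding B_def measure_axis_square[OF less_imp_le[OF L(1)]] by (intro mult_left_mono) auto
  also have "\<dots> = Q * n powr (p/2)" using L by (simp add: Q_def R_def)
  finally have "Lp_avg p B (exp_sum A) \<le> (Q * n powr (p/2)) powr (1/p)"
    unfolding Lp_avg_def using p L
    by (intro powr_mono2 mult_nonneg_nonneg) (auto simp: set_lebesgue_integral_def intro!: Bochner_Integration.integral_nonneg)
  also have "\<dots> = Q powr (1/p) * n powr (1/2)"
    using p by (simp add: powr_mult powr_powr)
  also have "\<dots> \<le> Q powr 1 * n powr (1/2)"
    using Q p by (intro mult_right_mono powr_mono) auto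
  also have "\<dots> = Q * sqrt n" using Q by (simp add: powr_half_sqrt n_def)
  finally show ?thesis by (simp add: Q_def Y_def n_def B_def)
qed

theorem propositionA10:
  "\<exists>c>0. \<forall>C0::real. 0 < C0 \<and> C0 < 1/100 \<and> C0 < c \<and> 1 / C0 \<in> \<nat> \<longrightarrow>
    (\<exists>K \<delta>0 :: real. 0 < K \<and> 0 < \<delta>0 \<and> \<delta>0 < 1 \<and>
      (\<forall>(\<delta>::real) (N::nat) (\<tau>0::real) (A :: (real \<times> real) set).
         0 < \<delta> \<and> \<delta> < \<delta>0 \<and>
         C0 ^ (3 * 3 ^ N) \<le> \<delta> \<and> \<delta> \<le> C0 ^ (2 * 3 ^ N) \<and>
         \<tau>0 = C0 ^ (2 * 2 ^ N) \<and>
         A \<subseteq> {(x, y). x\<^sup>2 + y\<^sup>2 = 1} \<and>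
         (\<forall>a\<in>A. \<forall>b\<in>A. a \<noteq> b \<longrightarrow> \<delta> \<le> dist a b) \<longrightarrow>
         (\<forall>p::real. 4 < p \<and> p < 6 \<longrightarrow>
           (\<forall>u v :: real.
              Lp_avg p (axis_square (1 / \<delta> * real_of_int \<lceil>1 / \<delta>\<^sup>2\<rceil> * (1 / \<tau>0\<^sup>2)) u v) (exp_sum A)
              \<le> exp (K * ln (1 / \<delta>) powr (1 - sigma_exp p) * ln (ln (1 / \<delta>)) powr K)
                 * sqrt (real (card A))))))"
proof -
  \<comment> \<open>The prefactor passed to \<open>parameter_choice\<close> is the constant lost in
    \<open>Lp_avg_exp_sum_le\<close>.\<close>
  obtain K :: real where K: "1 \<le> K" and params: "\<And>p \<delta> :: real. 4 < p \<Longrightarrow> p < 6 \<Longrightarrow> 0 < \<delta> \<Longrightarrow> \<delta> < exp (-3) \<Longrightarrow>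
    \<exists>k m \<eta> \<Gamma>. 4 \<le> k \<and> (4 / k) ^ (2 ^ m) \<le> \<delta> \<and> 0 \<le> \<eta> \<and> 8 * k ^ 6 \<le> \<Gamma> \<and> 2 * 4 ^ 6 \<le> k powr \<eta>
      \<and> 2 * ((2 * k) ^ 17 * decouple_const ^ (m + 1)) \<le> \<Gamma> powr ((2 / (p - 2)) ^ m)
      \<and> (4 * exp 1 * 10 ^ 7) * (\<Gamma> * (1 / \<delta>) powr \<eta>) \<le> exp (K * ln (1 / \<delta>) powr (1 - sigma_exp p) * ln (ln (1 / \<delta>)) powr K)"
    by (rule parameter_choice[of "4 * exp 1 * 10 ^ 7"]) blast
  have main: "Lp_avg p (axis_square (1 / \<delta> * real_of_int \<lceil>1 / \<delta>\<^sup>2\<rceil> * (1 / \<tau>\<^sup>2)) u v) (exp_sum A)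
      \<le> exp (K * ln (1 / \<delta>) powr (1 - sigma_exp p) * ln (ln (1 / \<delta>)) powr K) * sqrt (real (card A))"
    if \<delta>: "0 < \<delta>" "\<delta> < exp (-3)" and \<tau>: "0 < \<tau>" "\<tau> \<le> 1" and A: "A \<subseteq> {(x, y). x\<^sup>2 + y\<^sup>2 = 1}"
      and sep: "\<forall>a\<in>A. \<forall>b\<in>A. a \<noteq> b \<longrightarrow> \<delta> \<le> dist a b" and p: "4 < p" "p < 6"
    for \<delta> \<tau> p u v :: real and A
  proof -
    define L where "L = 1 / \<delta> * real_of_int \<lceil>1 / \<delta>\<^sup>2\<rceil> * (1 / \<tau>\<^sup>2)"
    \<comment> \<open>The side length is at least \<delta>^(-3), so 2 / L \<le> 2 \<delta>^3, and
      \<delta> \<le> 1/8 brings this below \<delta>^2 / 4.\<close>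
    have "8 * exp (-3) \<le> (1::real)"
      using exp_lower_Taylor_quadratic[of "3::real"] by (simp add: exp_minus field_simps)
    then have \<delta>8: "\<delta> \<le> 1 / 8" using \<delta> by simp
    have "0 \<le> real_of_int \<lceil>1 / \<delta>\<^sup>2\<rceil>" by (rule order_trans[OF _ le_of_int_ceiling]) simp
    then have "1 / \<delta> * (1 / \<delta>\<^sup>2) * 1 \<le> L"
      unfolding L_def using \<delta> \<tau> by (intro mult_mono) (auto simp: power_le_one)
    then have L: "1 / \<delta> ^ 3 \<le> L" by (simp add: power2_eq_square power3_eq_cube)
    have L0: "0 < L" using less_le_trans[OF _ L, of 0] \<delta> by simp
    have "2 / L \<le> 2 * \<delta> ^ 3"
      using L L0 \<delta> by (simp add: field_simps)
    also have "\<dots> = 2 * \<delta> * \<delta>\<^sup>2" by (simp add: power2_eq_square power3_eq_cube)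
    also have "\<dots> \<le> 1 / 4 * \<delta>\<^sup>2" using \<delta>8 by (intro mult_right_mono) auto
    finally have L2: "2 / L \<le> \<delta>\<^sup>2 / 4" by simp
    from params[OF p \<delta>] obtain k m \<eta> \<Gamma> where k: "4 \<le> k" "(4 / k) ^ (2 ^ m) \<le> \<delta>" "0 \<le> \<eta>" "8 * k ^ 6 \<le> \<Gamma>"
      "2 * 4 ^ 6 \<le> k powr \<eta>" "2 * ((2 * k) ^ 17 * decouple_const ^ (m + 1)) \<le> \<Gamma> powr ((2 / (p - 2)) ^ m)"
      and fin: "(4 * exp 1 * 10 ^ 7) * (\<Gamma> * (1 / \<delta>) powr \<eta>) \<le> exp (K * ln (1 / \<delta>) powr (1 - sigma_exp p) * ln (ln (1 / \<delta>)) powr K)"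
      by blast
    have "Lp_avg p (axis_square L u v) (exp_sum A) \<le> 4 * exp 1 * 10 ^ 7 * (\<Gamma> * (1 / \<delta>) powr \<eta>) * sqrt (real (card A))"
      using \<delta>8 by (intro Lp_avg_exp_sum_le[OF p \<delta>(1) _ L0 L2 k A sep]) simp
    also have "\<dots> \<le> exp (K * ln (1 / \<delta>) powr (1 - sigma_exp p) * ln (ln (1 / \<delta>)) powr K) * sqrt (real (card A))"
      using fin by (intro mult_right_mono) auto
    finally show ?thesis by (simp add: L_def)
  qed
  show ?thesis
  proof (rule exI[of _ 1], intro conjI allI impI)
    fix C0 :: real
    assume C0: "0 < C0 \<and> C0 < 1/100 \<and> C0 < 1 \<and> 1 / C0 \<in> \<nat>"
    show "\<exists>K \<delta>0 :: real. 0 < K \<and> 0 < \<delta>0 \<and> \<delta>0 < 1 \<and>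
      (\<forall>(\<delta>::real) (N::nat) (\<tau>0::real) (A :: (real \<times> real) set).
         0 < \<delta> \<and> \<delta> < \<delta>0 \<and>
         C0 ^ (3 * 3 ^ N) \<le> \<delta> \<and> \<delta> \<le> C0 ^ (2 * 3 ^ N) \<and>
         \<tau>0 = C0 ^ (2 * 2 ^ N) \<and>
         A \<subseteq> {(x, y). x\<^sup>2 + y\<^sup>2 = 1} \<and>
         (\<forall>a\<in>A. \<forall>b\<in>A. a \<noteq> b \<longrightarrow> \<delta> \<le> dist a b) \<longrightarrow>
         (\<forall>p::real. 4 < p \<and> p < 6 \<longrightarrow>
           (\<forall>u v :: real.
              Lp_avg p (axis_square (1 / \<delta> * real_of_int \<lceil>1 / \<delta>\<^sup>2\<rceil> * (1 / \<tau>0\<^sup>2)) u v) (exp_sum A)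
              \<le> exp (K * ln (1 / \<delta>) powr (1 - sigma_exp p) * ln (ln (1 / \<delta>)) powr K)
                 * sqrt (real (card A)))))"
    proof (rule exI[of _ K], rule exI[of _ "exp (-3)"], intro conjI allI impI, goal_cases)
      case (4 \<delta> N \<tau>0 A p u v)
      have "0 < \<tau>0" "\<tau>0 \<le> 1" using 4 C0 by (auto intro!: power_le_one)
      then show ?case using 4 by (intro main) auto
    qed (use K in auto)
  qed simp
qed

end
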